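(* Let $d\geq 3$ and let $(M,g)$ be the Kasner spacetime $M=(0,\infty)\times\mathbb{R}^d$, $g=-dt^2+\sum_{i=1}^d t^{2p_i}\,dx_i^2$, with $\sum_i p_i=1$, $\sum_i p_i^2=1$ and at least one $p_i<0$, time-oriented by $\partial_t$. Then $(M,g)$ is future $C^0$-inextendible, i.e. there is no $C^0$-extension $\iota:M\hookrightarrow\tilde M$ with $\partial^+\iota(M)\neq\emptyset$.
   Context: A $C^0$-extension is a smooth isometric embedding $\iota:M\hookrightarrow\tilde M$ into a Lorentzian manifold $(\tilde M,\tilde g)$ of the same dimension with continuous metric $\tilde g$, such that $\partial\iota(M)\neq\emptyset$. A timelike curve is a piecewise smooth curve whose tangent vectors (where defined) are timelike and whose one-sided derivatives at break points lie in the same component of the timelike cone; it is future directed timelike (FDTL) if its tangents lie in the future cone. The future boundary $\partial^+\iota(M)$ is the set of $p\in\partial\iota(M)$ for which there is a smooth timelike curve $\gamma:[0,1]\to\tilde M$ with $\gamma([0,1))\subseteq\iota(M)$, $\iota^{-1}\circ\gamma|_{[0,1)}$ FDTL in $M$, and $\gamma(1)=p$. *)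

theory Defs
  imports "HOL-Analysis.Analysis"
begin

fun iter_dderiv :: "'a::euclidean_space list \<Rightarrow> ('a \<Rightarrow> 'c::euclidean_space) \<Rightarrow> 'a \<Rightarrow> 'c" where
  "iter_dderiv [] f = f"
| "iter_dderiv (v # vs) f = (\<lambda>x. frechet_derivative (iter_dderiv vs f) (at x) v)"

definition smooth_on :: "'a::euclidean_space set \<Rightarrow> ('a \<Rightarrow> 'c::euclidean_space) \<Rightarrow> bool" where
  "smooth_on S f \<longleftrightarrow> (\<forall>vs. \<forall>x\<in>S. iter_dderiv vs f differentiable (at x))"

type_synonym 'd spt = "real \<times> (real^'d)"

definition minkowski :: "'d::finite spt \<Rightarrow> 'd spt \<Rightarrow> real" where
  "minkowski v w = - (fst v * fst w) + snd v \<bullet> snd w"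

definition lorentz_form :: "('d::finite spt \<Rightarrow> 'd spt \<Rightarrow> real) \<Rightarrow> bool" where
  "lorentz_form B \<longleftrightarrow> (\<exists>L::'d spt \<Rightarrow> 'd spt. linear L \<and> bij L \<and> (\<forall>v w. B (L v) (L w) = minkowski v w))"

text \<open>A smooth (d+1)-manifold (topology X, smooth atlas A of charts (U, phi)) with a
  continuous Lorentzian metric, given in each chart c and chart point y by G c y.\<close>
definition C0_lorentzian_manifold ::
  "'b topology \<Rightarrow> ('b set \<times> ('b \<Rightarrow> 'd::finite spt)) set
     \<Rightarrow> ('b set \<times> ('b \<Rightarrow> 'd spt) \<Rightarrow> 'd spt \<Rightarrow> 'd spt \<Rightarrow> 'd spt \<Rightarrow> real) \<Rightarrow> bool" where
  "C0_lorentzian_manifold X A G \<longleftrightarrow>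
     Hausdorff_space X \<and> second_countable X \<and>
     (\<forall>p\<in>topspace X. \<exists>(U,\<phi>)\<in>A. p \<in> U) \<and>
     (\<forall>(U,\<phi>)\<in>A. openin X U \<and> open (\<phi> ` U) \<and>
         homeomorphic_map (subtopology X U) (top_of_set (\<phi> ` U)) \<phi>) \<and>
     (\<forall>(U,\<phi>)\<in>A. \<forall>(V,\<psi>)\<in>A. smooth_on (\<phi> ` (U \<inter> V)) (\<psi> \<circ> inv_into U \<phi>)) \<and>
     (\<forall>(U,\<phi>)\<in>A. \<forall>y\<in>\<phi> ` U. lorentz_form (G (U,\<phi>) y)) \<and>
     (\<forall>(U,\<phi>)\<in>A. \<forall>v w. continuous_on (\<phi> ` U) (\<lambda>y. G (U,\<phi>) y v w)) \<and>
     (\<forall>(U,\<phi>)\<in>A. \<forall>(V,\<psi>)\<in>A. \<forall>p\<in>U \<inter> V. \<forall>v w.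
         G (U,\<phi>) (\<phi> p) v w =
         G (V,\<psi>) (\<psi> p) (frechet_derivative (\<psi> \<circ> inv_into U \<phi>) (at (\<phi> p)) v)
                         (frechet_derivative (\<psi> \<circ> inv_into U \<phi>) (at (\<phi> p)) w))"

definition smooth_map_into ::
  "'b topology \<Rightarrow> ('b set \<times> ('b \<Rightarrow> 'd::finite spt)) set \<Rightarrow> 'a::euclidean_space set \<Rightarrow> ('a \<Rightarrow> 'b) \<Rightarrow> bool" where
  "smooth_map_into X A S f \<longleftrightarrow>
     f ` S \<subseteq> topspace X \<and> continuous_map (top_of_set S) X f \<and>
     (\<forall>(U,\<phi>)\<in>A. smooth_on (S \<inter> f -` U) (\<phi> \<circ> f))"

definition kasner_M :: "'d::finite spt set" where
  "kasner_M = {q. fst q > 0}"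

definition kasner_g :: "real^'d::finite \<Rightarrow> 'd spt \<Rightarrow> 'd spt \<Rightarrow> 'd spt \<Rightarrow> real" where
  "kasner_g P q v w = - (fst v * fst w) + (\<Sum>i\<in>UNIV. fst q powr (2 * P $ i) * (snd v $ i) * (snd w $ i))"

definition kasner_fdtl :: "real^'d::finite \<Rightarrow> 'd spt \<Rightarrow> 'd spt \<Rightarrow> bool" where
  "kasner_fdtl P q v \<longleftrightarrow> kasner_g P q v v < 0 \<and> fst v > 0"

definition C0_extension ::
  "real^'d::finite \<Rightarrow> 'b topology \<Rightarrow> ('b set \<times> ('b \<Rightarrow> 'd spt)) set
     \<Rightarrow> ('b set \<times> ('b \<Rightarrow> 'd spt) \<Rightarrow> 'd spt \<Rightarrow> 'd spt \<Rightarrow> 'd spt \<Rightarrow> real) \<Rightarrow> ('d spt \<Rightarrow> 'b) \<Rightarrow> bool" where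
  "C0_extension P X A G \<iota> \<longleftrightarrow>
     C0_lorentzian_manifold X A G \<and>
     smooth_map_into X A kasner_M \<iota> \<and>
     inj_on \<iota> kasner_M \<and>
     homeomorphic_map (top_of_set kasner_M) (subtopology X (\<iota> ` kasner_M)) \<iota> \<and>
     (\<forall>(U,\<phi>)\<in>A. \<forall>q\<in>kasner_M. \<iota> q \<in> U \<longrightarrow>
        inj (frechet_derivative (\<phi> \<circ> \<iota>) (at q)) \<and>
        (\<forall>v w. G (U,\<phi>) (\<phi> (\<iota> q)) (frechet_derivative (\<phi> \<circ> \<iota>) (at q) v)
                                  (frechet_derivative (\<phi> \<circ> \<iota>) (at q) w) = kasner_g P q v w)) \<and>
     X frontier_of (\<iota> ` kasner_M) \<noteq> {}"

text \<open>Future boundary. A smooth curve on [0,1] is the restriction of a smooth curve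
  defined on an open interval containing [0,1].\<close>
definition future_boundary ::
  "real^'d::finite \<Rightarrow> 'b topology \<Rightarrow> ('b set \<times> ('b \<Rightarrow> 'd spt)) set
     \<Rightarrow> ('b set \<times> ('b \<Rightarrow> 'd spt) \<Rightarrow> 'd spt \<Rightarrow> 'd spt \<Rightarrow> 'd spt \<Rightarrow> real) \<Rightarrow> ('d spt \<Rightarrow> 'b) \<Rightarrow> 'b set" where
  "future_boundary P X A G \<iota> =
     {p \<in> X frontier_of (\<iota> ` kasner_M).
        \<exists>\<gamma> a b. a < 0 \<and> 1 < b \<and> smooth_map_into X A {a<..<b} \<gamma> \<and>
          (\<forall>s\<in>{0..1}. \<forall>(U,\<phi>)\<in>A. \<gamma> s \<in> U \<longrightarrow>
             G (U,\<phi>) (\<phi> (\<gamma> s)) (vector_derivative (\<phi> \<circ> \<gamma>) (at s))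
                                 (vector_derivative (\<phi> \<circ> \<gamma>) (at s)) < 0) \<and>
          \<gamma> ` {0..<1} \<subseteq> \<iota> ` kasner_M \<and>
          (\<forall>s\<in>{0..<1}. \<exists>v. ((\<lambda>r. the_inv_into kasner_M \<iota> (\<gamma> r)) has_vector_derivative v) (at s within {0..<1})
                              \<and> kasner_fdtl P (the_inv_into kasner_M \<iota> (\<gamma> s)) v) \<and>
          \<gamma> 1 = p}"

end

theory Submission
  imports Defs
begin

text \<open>
  A future boundary point p has a future directed timelike curve running into it. Spatial velocities
  are bounded as long as t is, so if t stayed bounded along the curve it would stay in a compact
  subset of M and p would lie in the image of M, which is open by invariance of domain. Hence t tends
  to infinity and the curve is a graph t \<mapsto> (t, x(t)).

  Take a chart around p in which the metric is close to Minkowski. In Kasner coordinates a curve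
  (t, z(t)) is timelike iff a convex function of z'(t) is less than 1, so two timelike graphs with
  common end points are joined by the straight-line homotopy through timelike graphs. If one of them
  starts and ends close to p inside the chart, a continuity argument keeps the whole homotopy in the
  chart, because timelike curves in the chart stay in a cone over their end points. All these curves
  therefore have uniformly bounded length.

  On the other hand all exponents satisfy p_i \<ge> -k for some k < 1. Start slightly below (a, x(a)), at
  (a', x(a)), and follow x ahead of time, along t \<mapsto> x(\<sigma>(t)) with \<sigma>(a') = a and \<sigma>(v) = v. The choice
  \<sigma>(t)^(1+k) = (1-e) t^(1+k) + e v^(1+k) slows the curve down by the uniform factor 1-e, where e is
  of order v^-(1+k), so its length is of order v^((1-k)/2), which is unbounded in v.
\<close>

section \<open>Spatial speed in Kasner coordinates\<close>

text \<open>A graph \<open>t \<mapsto> (t, z t)\<close> has velocity \<open>(1, z' t)\<close>, which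
  is timelike exactly when this quadratic form in \<open>z' t\<close> is below 1; one minus the form
  is then the squared rate of proper time.\<close>

definition spatial_sq :: "real^'d::finite \<Rightarrow> real \<Rightarrow> real^'d \<Rightarrow> real" where
  "spatial_sq P t v = (\<Sum>i\<in>UNIV. t powr (2 * P $ i) * (v $ i)\<^sup>2)"

lemma kasner_g_spatial_sq: "kasner_g P q w w = - (fst w)\<^sup>2 + spatial_sq P (fst q) (snd w)"
  by (simp add: kasner_g_def spatial_sq_def power2_eq_square mult.assoc)

text \<open>The weights are nonnegative and squaring is convex. This is what keeps straight-line
  homotopies between timelike graphs timelike.\<close>

lemma spatial_sq_convex:
  assumes "0 \<le> l" "l \<le> 1"
  shows "spatial_sq P t ((1 - l) *\<^sub>R u + l *\<^sub>R w) \<le> (1 - l) * spatial_sq P t u + l * spatial_sq P t w"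
proof -
  have sq: "((1 - l) * a + l * b)\<^sup>2 \<le> (1 - l) * a\<^sup>2 + l * b\<^sup>2" for a b :: real
  proof -
    have "(1 - l) * a\<^sup>2 + l * b\<^sup>2 - ((1 - l) * a + l * b)\<^sup>2 = l * (1 - l) * (a - b)\<^sup>2"
      by (simp add: power2_eq_square algebra_simps)
    moreover have "0 \<le> l * (1 - l) * (a - b)\<^sup>2" using assms by simp
    ultimately show ?thesis by linarith
  qed
  have "spatial_sq P t ((1 - l) *\<^sub>R u + l *\<^sub>R w)
      \<le> (\<Sum>i\<in>UNIV. t powr (2 * P $ i) * ((1 - l) * (u $ i)\<^sup>2 + l * (w $ i)\<^sup>2))"
    unfolding spatial_sq_def by (intro sum_mono mult_left_mono) (use sq in auto)
  also have "\<dots> = (1 - l) * spatial_sq P t u + l * spatial_sq P t w"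
    unfolding spatial_sq_def by (simp add: sum_distrib_left distrib_left sum.distrib mult.left_commute)
  finally show ?thesis .
qed

lemma spatial_sq_zero [simp]: "spatial_sq P t 0 = 0" by (simp add: spatial_sq_def)

text \<open>Used to copy the velocity of a curve at time \<open>s\<close> to an earlier time
  \<open>t\<close>. This changes squared lengths in direction \<open>i\<close> by
  \<open>(t / s) powr (2 * P $ i)\<close>, an increase if \<open>P $ i < 0\<close>. Since
  \<open>P $ i + k\<close> is nonnegative, slowing down by \<open>(t / s) powr k\<close> compensates
  in every direction.\<close>

lemma spatial_sq_delay:
  assumes "0 < t" "t \<le> s" and P: "\<And>i. - k \<le> P $ i"
  shows "spatial_sq P t ((c * (t / s) powr k) *\<^sub>R v) \<le> c\<^sup>2 * spatial_sq P s v"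
proof -
  have s: "0 < s" using assms by linarith
  have "t powr (2 * P $ i) * ((c * (t / s) powr k) * v $ i)\<^sup>2
      \<le> c\<^sup>2 * (s powr (2 * P $ i) * (v $ i)\<^sup>2)" for i
  proof -
    have "t powr (2 * P $ i) * ((t / s) powr k)\<^sup>2 = s powr (2 * P $ i) * (t / s) powr (2 * (P $ i + k))"
      using assms(1) s by (simp add: powr_divide powr_add distrib_left power2_eq_square flip: powr_add)
        (simp add: powr_add)
    moreover have "(t / s) powr (2 * (P $ i + k)) \<le> 1"
    proof -
      have "0 \<le> 2 * (P $ i + k)" using add_mono[OF P[of i] order_refl[of k]] by simp
      then show ?thesis using assms(1,2) s by (intro powr_le1) auto
    qed
    ultimately have "t powr (2 * P $ i) * ((t / s) powr k)\<^sup>2 \<le> s powr (2 * P $ i)"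
      by (simp add: mult_left_le)
    then have "(t powr (2 * P $ i) * ((t / s) powr k)\<^sup>2) * (c\<^sup>2 * (v $ i)\<^sup>2)
       \<le> s powr (2 * P $ i) * (c\<^sup>2 * (v $ i)\<^sup>2)"
      by (rule mult_right_mono) simp
    then show ?thesis by (simp add: power_mult_distrib mult_ac)
  qed
  then show ?thesis
    unfolding spatial_sq_def by (auto simp: sum_distrib_left intro!: sum_mono)
qed

lemma spatial_sq_scaleR: "spatial_sq P t (r *\<^sub>R v) = r\<^sup>2 * spatial_sq P t v"
  by (simp add: spatial_sq_def sum_distrib_left power_mult_distrib mult_ac)

text \<open>On a compact time interval each weight is at least its value at \<open>a\<close> or at
  \<open>T\<close>, depending on the sign of \<open>P $ i\<close>; adding the two end terms covers
  both signs at once.\<close>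

lemma norm_le_spatial_sq:
  assumes "0 < a" "a \<le> t" "t \<le> T"
  shows "norm v \<le> (\<Sum>i\<in>UNIV. a powr (- P $ i) + T powr (- P $ i)) * sqrt (spatial_sq P t v)"
proof -
  have "\<bar>v $ i\<bar> \<le> (a powr (- P $ i) + T powr (- P $ i)) * sqrt (spatial_sq P t v)" for i
  proof -
    have "(t powr (P $ i) * \<bar>v $ i\<bar>)\<^sup>2 = t powr (2 * P $ i) * (v $ i)\<^sup>2"
      using powr_add[of t "P $ i" "P $ i"] by (simp add: power_mult_distrib flip: power2_eq_square)
    also have "\<dots> \<le> spatial_sq P t v"
      unfolding spatial_sq_def by (rule member_le_sum) auto
    finally have "t powr (P $ i) * \<bar>v $ i\<bar> \<le> sqrt (spatial_sq P t v)"
      by (rule real_le_rsqrt)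
    then have "t powr (- P $ i) * (t powr (P $ i) * \<bar>v $ i\<bar>) \<le> t powr (- P $ i) * sqrt (spatial_sq P t v)"
      by (rule mult_left_mono) simp
    then have "\<bar>v $ i\<bar> \<le> t powr (- P $ i) * sqrt (spatial_sq P t v)"
      using assms by (simp add: powr_minus flip: mult.assoc)
    moreover have "t powr (- P $ i) \<le> a powr (- P $ i) + T powr (- P $ i)"
    proof (cases "P $ i \<le> 0")
      case True
      then have "t powr (- P $ i) \<le> T powr (- P $ i)" using assms by (intro powr_mono2) auto
      then show ?thesis by (simp add: add_increasing)
    next
      case False
      then have "t powr (- P $ i) \<le> a powr (- P $ i)" using assms by (intro powr_mono2') auto
      then show ?thesis by (simp add: add_increasing2)
    qed
    moreover have "0 \<le> sqrt (spatial_sq P t v)" by (simp add: spatial_sq_def sum_nonneg)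
    ultimately show ?thesis by (meson mult_right_mono order_trans)
  qed
  then have "(\<Sum>i\<in>UNIV. \<bar>v $ i\<bar>) \<le> (\<Sum>i\<in>UNIV. (a powr (- P $ i) + T powr (- P $ i)) * sqrt (spatial_sq P t v))"
    by (rule sum_mono)
  then show ?thesis
    using norm_le_l1_cart[of v] by (simp add: sum_distrib_right)
qed

section \<open>Range of the Kasner exponents\<close>

text \<open>An exponent at or below -1 would exhaust the sum of squares, so all others would vanish
  and the sum of exponents would be negative.\<close>

lemma kasner_exponent_gt:
  fixes P :: "real^'d::finite"
  assumes "(\<Sum>i\<in>UNIV. P $ i) = 1" "(\<Sum>i\<in>UNIV. (P $ i)\<^sup>2) = 1"
  shows "- 1 < P $ i"
proof (rule ccontr)
  assume "\<not> - 1 < P $ i"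
  then have i: "P $ i \<le> - 1" by simp
  then have "1 \<le> (P $ i)\<^sup>2" using power_mono[of 1 "- P $ i" 2] by simp
  then have "(\<Sum>j\<in>UNIV - {i}. (P $ j)\<^sup>2) \<le> 0"
    using assms(2) by (simp add: sum.remove[of UNIV i])
  then have "(\<Sum>j\<in>UNIV - {i}. (P $ j)\<^sup>2) = 0" by (intro antisym sum_nonneg) auto
  then have "\<forall>j\<in>UNIV - {i}. P $ j = 0" by (subst (asm) sum_nonneg_eq_0_iff) auto
  then have "(\<Sum>j\<in>UNIV - {i}. P $ j) = 0" by simp
  then show False using assms(1) i by (simp add: sum.remove[of UNIV i])
qed

section \<open>Timelike graphs in a nearly Minkowskian chart\<close>

text \<open>\<open>W\<close> is the part of \<open>kasner_M\<close> seen by a chart and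
  \<open>\<Psi>\<close> the chart, normalised so that its first coordinate acts as time.
  \<open>cone\<close> and \<open>len\<close> are what is kept of the metric being close to
  Minkowski. By \<open>closed\<close>, a curve in \<open>kasner_M\<close> cannot leave
  \<open>W\<close> while the norm of \<open>\<Psi>\<close> stays at most
  \<open>\<rho>\<close>.\<close>

locale kasner_chart =
  fixes P :: "real^'d::finite" and W :: "'d spt set"
    and \<Psi> :: "'d spt \<Rightarrow> 'd spt" and \<Psi>' :: "'d spt \<Rightarrow> 'd spt \<Rightarrow> 'd spt" and \<rho> :: real
  assumes W_open: "open W"
    and deriv: "q \<in> W \<Longrightarrow> (\<Psi> has_derivative \<Psi>' q) (at q)"
    and cone: "q \<in> W \<Longrightarrow> kasner_g P q w w < 0 \<Longrightarrow> norm (snd (\<Psi>' q w)) \<le> 2 * \<bar>fst (\<Psi>' q w)\<bar>"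
    and len: "q \<in> W \<Longrightarrow> kasner_g P q w w < 0 \<Longrightarrow> - kasner_g P q w w \<le> 4 * (fst (\<Psi>' q w))\<^sup>2"
    and cont: "continuous_on W (\<lambda>q. fst (\<Psi>' q (1, 0)))"
    and closed: "closedin (top_of_set kasner_M) {q \<in> W. norm (\<Psi> q) \<le> \<rho>}"
begin

section \<open>Integrated cone and length bounds\<close>

text \<open>By convexity all vectors on the segment from \<open>(1, 0)\<close> to
  \<open>(1, v)\<close> are timelike. Otherwise the chart time component would vanish at one of
  them, and \<open>len\<close> would prevent that vector from being timelike.\<close>

lemma sign_fst:
  assumes q: "q \<in> W" and e: "\<epsilon> = 1 \<or> \<epsilon> = -1" and pos: "0 < \<epsilon> * fst (\<Psi>' q (1, 0))" and v: "spatial_sq P (fst q) v < 1"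
  shows "0 < \<epsilon> * fst (\<Psi>' q (1, v))"
proof (rule ccontr)
  assume neg: "\<not> ?thesis"
  define A where "A = \<epsilon> * fst (\<Psi>' q (1, 0))"
  define B where "B = \<epsilon> * fst (\<Psi>' q (1, v))"
  have AB: "0 < A" "B \<le> 0" using pos neg by (auto simp: A_def B_def)
  interpret l: linear "\<Psi>' q" using deriv[OF q] has_derivative_linear by blast
  \<comment> \<open>The zero of the affine function with value \<open>A\<close> at 0 and
    \<open>B\<close> at 1.\<close>
  define l where "l = A / (A - B)"
  have l: "0 \<le> l" "l \<le> 1" "(1 - l) * A + l * B = 0"
    using AB by (auto simp: l_def field_simps)
  have eq: "(1, l *\<^sub>R v) = (1 - l) *\<^sub>R (1, 0) + l *\<^sub>R (1, v)" by simp
  have "spatial_sq P (fst q) (l *\<^sub>R v) < 1"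
  proof -
    have "spatial_sq P (fst q) ((1 - l) *\<^sub>R 0 + l *\<^sub>R v) \<le> (1 - l) * spatial_sq P (fst q) 0 + l * spatial_sq P (fst q) v"
      by (rule spatial_sq_convex) (use l in auto)
    moreover have "l * spatial_sq P (fst q) v < 1"
    proof (cases "l = 0")
      case False
      then have "l * spatial_sq P (fst q) v < l * 1" using v l by (intro mult_strict_left_mono) auto
      then show ?thesis using l by linarith
    qed simp
    ultimately show ?thesis by simp
  qed
  then have tl: "kasner_g P q (1, l *\<^sub>R v) (1, l *\<^sub>R v) < 0" by (simp add: kasner_g_spatial_sq)
  have "fst (\<Psi>' q (1, l *\<^sub>R v)) = (1 - l) * fst (\<Psi>' q (1, 0)) + l * fst (\<Psi>' q (1, v))"
    by (simp only: eq l.add l.scale fst_add fst_scaleR real_scaleR_def)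
  then have "\<epsilon> * fst (\<Psi>' q (1, l *\<^sub>R v)) = 0"
    using l(3) unfolding A_def B_def by (simp only: distrib_left mult.left_commute)
  then have "fst (\<Psi>' q (1, l *\<^sub>R v)) = 0" using e by auto
  then show False using len[OF q tl] tl by simp
qed

text \<open>By \<open>sign_fst\<close> the signed chart time increases along the graph, so the
  pointwise bounds \<open>cone\<close> and \<open>len\<close> integrate by the mean value
  inequality. The number \<open>sqrt \<eta> * (v - u)\<close> is a lower bound for the proper time
  of the graph.\<close>

lemma segment:
  assumes uv: "u \<le> v" and e: "\<epsilon> = 1 \<or> \<epsilon> = -1"
    and zc: "continuous_on {u..v} z"
    and zd: "\<And>t. u < t \<Longrightarrow> t < v \<Longrightarrow> (z has_vector_derivative z' t) (at t)"
    and zW: "\<And>t. u \<le> t \<Longrightarrow> t \<le> v \<Longrightarrow> (t, z t) \<in> W"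
    and pos: "\<And>t. u \<le> t \<Longrightarrow> t \<le> v \<Longrightarrow> 0 < \<epsilon> * fst (\<Psi>' (t, z t) (1, 0))"
    and tl: "\<And>t. u < t \<Longrightarrow> t < v \<Longrightarrow> spatial_sq P t (z' t) < 1"
  shows segment_cone: "norm (snd (\<Psi> (v, z v)) - snd (\<Psi> (u, z u))) \<le> 2 * (\<epsilon> * fst (\<Psi> (v, z v)) - \<epsilon> * fst (\<Psi> (u, z u)))"
    and segment_length: "(\<And>t. u < t \<Longrightarrow> t < v \<Longrightarrow> spatial_sq P t (z' t) \<le> 1 - \<eta>) \<Longrightarrow>  0 \<le> \<eta> \<Longrightarrow>
       sqrt \<eta> * (v - u) \<le> 2 * (\<epsilon> * fst (\<Psi> (v, z v)) - \<epsilon> * fst (\<Psi> (u, z u)))"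
proof -
  define Y where "Y t = \<Psi> (t, z t)" for t
  define Y' where "Y' t = \<Psi>' (t, z t) (1, z' t)" for t
  have Psi_cont: "continuous_on W \<Psi>"
    using deriv W_open by (meson continuous_at_imp_continuous_on has_derivative_continuous)
  have Yc: "continuous_on {u..v} Y"
    unfolding Y_def
    by (rule continuous_on_compose2[OF Psi_cont]) (auto intro!: continuous_intros zc zW)
  have Yd: "(Y has_vector_derivative Y' t) (at t)" if "u < t" "t < v" for t
  proof -
    have "((\<lambda>t. (t, z t)) has_vector_derivative (1, z' t)) (at t)"
      by (intro has_vector_derivative_Pair has_vector_derivative_id zd that)
    from vector_derivative_diff_chain_within[OF this, of \<Psi> "\<Psi>' (t, z t)"] deriv[OF zW, of t] that
    show ?thesis
      unfolding Y_def Y'_def by (auto simp: o_def has_derivative_at_withinI)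
  qed
  have sp: "0 < \<epsilon> * fst (Y' t)" if "u < t" "t < v" for t
    unfolding Y'_def
    using sign_fst[of "(t, z t)" \<epsilon> "z' t"] zW[of t] pos[of t] e tl[OF that] that by simp
  have absf: "\<bar>fst (Y' t)\<bar> = \<epsilon> * fst (Y' t)" if "u < t" "t < v" for t
    using sp[OF that] e by auto
  have Fd: "((\<lambda>t. 2 * (\<epsilon> * fst (Y t))) has_vector_derivative 2 * (\<epsilon> * fst (Y' t))) (at t)"
    if "u < t" "t < v" for t
    by (intro bounded_linear.has_vector_derivative[OF _ Yd[OF that], of "\<lambda>y. 2 * (\<epsilon> * fst y)"]
        bounded_linear_const_mult bounded_linear_fst)
  have Fc: "continuous_on {u..v} (\<lambda>t. 2 * (\<epsilon> * fst (Y t)))"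
    by (intro continuous_intros Yc)
  have tl': "kasner_g P (t, z t) (1, z' t) (1, z' t) < 0" if "u < t" "t < v" for t
    using tl[OF that] by (simp add: kasner_g_spatial_sq)
  show "norm (snd (\<Psi> (v, z v)) - snd (\<Psi> (u, z u))) \<le> 2 * (\<epsilon> * fst (\<Psi> (v, z v)) - \<epsilon> * fst (\<Psi> (u, z u)))"
  proof (cases "u = v")
    case False
    have "norm (snd (Y v) - snd (Y u)) \<le> 2 * (\<epsilon> * fst (Y v)) - 2 * (\<epsilon> * fst (Y u))"
    proof (rule differentiable_bound_general)
      show "u < v" using False uv by simp
      show "continuous_on {u..v} (\<lambda>t. snd (Y t))" by (intro continuous_intros Yc)
      show "((\<lambda>t. snd (Y t)) has_vector_derivative snd (Y' t)) (at t)" if "u < t" "t < v" for t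
        using bounded_linear.has_vector_derivative[OF bounded_linear_snd Yd[OF that]] .
      show "norm (snd (Y' t)) \<le> 2 * (\<epsilon> * fst (Y' t))" if "u < t" "t < v" for t
        using cone[OF zW tl'[OF that]] that absf[OF that] by (simp add: Y'_def)
    qed (use Fc Fd in auto)
    then show ?thesis by (simp add: Y_def algebra_simps)
  qed simp
  show "sqrt \<eta> * (v - u) \<le> 2 * (\<epsilon> * fst (\<Psi> (v, z v)) - \<epsilon> * fst (\<Psi> (u, z u)))"
    if eta: "\<And>t. u < t \<Longrightarrow> t < v \<Longrightarrow> spatial_sq P t (z' t) \<le> 1 - \<eta>" "0 \<le> \<eta>"
  proof (cases "u = v")
    case False
    have "norm (sqrt \<eta> * v - sqrt \<eta> * u) \<le> 2 * (\<epsilon> * fst (Y v)) - 2 * (\<epsilon> * fst (Y u))"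
    proof (rule differentiable_bound_general)
      show "u < v" using False uv by simp
      show "continuous_on {u..v} (\<lambda>t. sqrt \<eta> * t)" by (intro continuous_intros)
      show "((\<lambda>t. sqrt \<eta> * t) has_vector_derivative sqrt \<eta>) (at t)" for t
        by (auto intro!: derivative_eq_intros simp flip: has_real_derivative_iff_has_vector_derivative)
      show "norm (sqrt \<eta>) \<le> 2 * (\<epsilon> * fst (Y' t))" if "u < t" "t < v" for t
      proof -
        have "\<eta> \<le> (2 * \<bar>fst (Y' t)\<bar>)\<^sup>2"
          using len[OF zW tl'[OF that]] that eta(1)[OF that] by (simp add: Y'_def kasner_g_spatial_sq)
        then have "sqrt \<eta> \<le> 2 * \<bar>fst (Y' t)\<bar>" by (rule real_le_lsqrt[rotated]) simp
        then show ?thesis using absf[OF that] eta(2) by simp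
      qed
    qed (use Fc Fd in auto)
    then show ?thesis by (simp add: Y_def algebra_simps)
  qed simp
qed

section \<open>Deforming timelike graphs inside the chart\<close>

text \<open>\<open>z0\<close> is a known curve in the chart, \<open>z1\<close> a timelike competitor
  with the same ends, \<open>m\<close> a possible kink. The parameters \<open>l\<close> whose
  interpolated curve stays in \<open>W\<close> form an open and closed subset of the unit interval
  containing 0. So \<open>z1\<close> lies in \<open>W\<close> too, and \<open>segment_length\<close>
  applies to it.\<close>

lemma homotopy_length_bound:
  fixes z0 z1 :: "real \<Rightarrow> real^'d"
  assumes um: "0 < u" "u \<le> m" "m \<le> v"
    and c: "continuous_on {u..v} z0" "continuous_on {u..v} z1"
    and d0: "\<And>t. u < t \<Longrightarrow> t < v \<Longrightarrow> t \<noteq> m \<Longrightarrow> (z0 has_vector_derivative z0' t) (at t)"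
    and d1: "\<And>t. u < t \<Longrightarrow> t < v \<Longrightarrow> t \<noteq> m \<Longrightarrow> (z1 has_vector_derivative z1' t) (at t)"
    and t0: "\<And>t. u < t \<Longrightarrow> t < v \<Longrightarrow> t \<noteq> m \<Longrightarrow> spatial_sq P t (z0' t) < 1"
    and t1: "\<And>t. u < t \<Longrightarrow> t < v \<Longrightarrow> t \<noteq> m \<Longrightarrow> spatial_sq P t (z1' t) < 1"
    and eta: "\<And>t. u < t \<Longrightarrow> t < v \<Longrightarrow> t \<noteq> m \<Longrightarrow> spatial_sq P t (z1' t) \<le> 1 - \<eta>" "0 \<le> \<eta>"
    and ends: "z1 u = z0 u" "z1 v = z0 v"
    and small: "norm (\<Psi> (u, z0 u)) \<le> \<rho> / 6" "norm (\<Psi> (v, z0 v)) \<le> \<rho> / 6"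
    and z0W: "\<And>t. u \<le> t \<Longrightarrow> t \<le> v \<Longrightarrow> (t, z0 t) \<in> W"
  shows "sqrt \<eta> * (v - u) \<le> \<rho>"
proof -
  define H where "H l t = (1 - l) *\<^sub>R z0 t + l *\<^sub>R z1 t" for l t
  define H' where "H' l t = (1 - l) *\<^sub>R z0' t + l *\<^sub>R z1' t" for l t
  have Hu: "H l u = z0 u" and Hv: "H l v = z0 v" for l
    by (simp_all add: H_def ends flip: scaleR_add_left)
  have Hc: "continuous_on {u..v} (H l)" for l
    unfolding H_def by (intro continuous_intros c)
  have Hd: "(H l has_vector_derivative H' l t) (at t)" if "u < t" "t < v" "t \<noteq> m" for l t
    unfolding H_def H'_def
    by (intro has_vector_derivative_add bounded_linear.has_vector_derivative[OF bounded_linear_scaleR_right] d0 d1 that)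
  have Ht: "spatial_sq P t (H' l t) < 1" if "u < t" "t < v" "t \<noteq> m" "l \<in> {0..1}" for l t
  proof -
    have l: "0 \<le> l" "l \<le> 1" using that by auto
    have "(1 - l) * spatial_sq P t (z0' t) + l * spatial_sq P t (z1' t) < 1"
      using convex_bound_lt[OF t0[OF that(1-3)] t1[OF that(1-3)], of "1 - l" l] l by simp
    then show ?thesis unfolding H'_def using spatial_sq_convex[OF l, of P t "z0' t" "z1' t"] by linarith
  qed
  have e0: "kasner_g P q (1, 0) (1, 0) < 0" for q by (simp add: kasner_g_spatial_sq)
  have nz: "fst (\<Psi>' q (1, 0)) \<noteq> 0" if "q \<in> W" for q
    using len[OF that e0] by (auto simp: kasner_g_spatial_sq)
  \<comment> \<open>The chart may reverse the time orientation; the sign is constant along connected curves.\<close>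
  define e :: real where "e = (if 0 < fst (\<Psi>' (u, z0 u) (1, 0)) then 1 else -1)"
  have e: "e = 1 \<or> e = -1" by (simp add: e_def)
  have eu: "0 < e * fst (\<Psi>' (u, z0 u) (1, 0))"
    using nz[OF z0W[of u]] um by (auto simp: e_def)
  have pos: "0 < e * fst (\<Psi>' (t, H l t) (1, 0))"
    if inW: "\<And>t. u \<le> t \<Longrightarrow> t \<le> v \<Longrightarrow> (t, H l t) \<in> W" and t: "u \<le> t" "t \<le> v" for l t
  proof (rule ccontr)
    assume neg: "\<not> ?thesis"
    have "continuous_on {u..t} (\<lambda>s. fst (\<Psi>' (s, H l s) (1, 0)))"
      by (rule continuous_on_compose2[OF cont])
         (use t in \<open>auto intro!: continuous_intros continuous_on_subset[OF Hc] inW\<close>)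
    then have "continuous_on {u..t} (\<lambda>s. e * fst (\<Psi>' (s, H l s) (1, 0)))"
      by (rule continuous_on_mult_left)
    then have "\<exists>s. u \<le> s \<and> s \<le> t \<and> e * fst (\<Psi>' (s, H l s) (1, 0)) = 0"
      by (intro IVT2') (use neg eu t in \<open>auto simp: Hu\<close>)
    then show False using nz inW t e by (metis dual_order.trans mult_eq_0_iff zero_neq_neg_one zero_neq_one)
  qed
  have step: "norm (snd (\<Psi> (t, H l t)) - snd (\<Psi> (s, H l s)))
        \<le> 2 * (e * fst (\<Psi> (t, H l t)) - e * fst (\<Psi> (s, H l s)))"
    if inW: "\<And>t. u \<le> t \<Longrightarrow> t \<le> v \<Longrightarrow> (t, H l t) \<in> W" and l: "l \<in> {0..1}"
      and st: "u \<le> s" "s \<le> t" "t \<le> v" for l s t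
  proof -
    \<comment> \<open>\<open>segment_cone\<close> wants a derivative at all interior points, so
      \<open>m\<close> may only be an end; the estimates on the two sides of \<open>m\<close> are
      added by the triangle inequality.\<close>
    have piece: "norm (snd (\<Psi> (t, H l t)) - snd (\<Psi> (s, H l s)))
        \<le> 2 * (e * fst (\<Psi> (t, H l t)) - e * fst (\<Psi> (s, H l s)))"
      if "u \<le> s" "s \<le> t" "t \<le> v" "t \<le> m \<or> m \<le> s" for s t
      by (rule segment_cone[where z' = "H' l"])
         (use that in \<open>auto intro!: continuous_on_subset[OF Hc] Hd Ht l pos inW e\<close>)
    show ?thesis
    proof (cases "t \<le> m \<or> m \<le> s")
      case False
      then show ?thesis
        using piece[of s m] piece[of m t] st um
          norm_triangle_ineq[of "snd (\<Psi> (t, H l t)) - snd (\<Psi> (m, H l m))" "snd (\<Psi> (m, H l m)) - snd (\<Psi> (s, H l s))"]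
        by simp
    qed (use piece st in auto)
  qed
  have ends_small: "\<bar>fst (\<Psi> (u, z0 u))\<bar> \<le> \<rho> / 6" "\<bar>fst (\<Psi> (v, z0 v))\<bar> \<le> \<rho> / 6" "norm (snd (\<Psi> (u, z0 u))) \<le> \<rho> / 6"
    using small norm_fst_le[of "fst (\<Psi> (u, z0 u))" "snd (\<Psi> (u, z0 u))"]
      norm_fst_le[of "fst (\<Psi> (v, z0 v))" "snd (\<Psi> (v, z0 v))"]
      norm_snd_le[of "snd (\<Psi> (u, z0 u))" "fst (\<Psi> (u, z0 u))"]
    by auto
  \<comment> \<open>Signed chart time increases between the ends, so it stays within
    \<open>\<rho> / 6\<close> of zero and gains at most \<open>\<rho> / 3\<close>. The cone bounds
    the space part by \<open>\<rho> / 6 + 2 * (\<rho> / 3)\<close>, and with the time part this adds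
    up to \<open>\<rho>\<close>; hence the 6 in the smallness of the ends.\<close>
  have confine: "norm (\<Psi> (t, H l t)) \<le> \<rho>"
    if inW: "\<And>t. u \<le> t \<Longrightarrow> t \<le> v \<Longrightarrow> (t, H l t) \<in> W" and l: "l \<in> {0..1}"
      and t: "u \<le> t" "t \<le> v" for l t
  proof -
    have 1: "norm (snd (\<Psi> (t, H l t)) - snd (\<Psi> (u, z0 u))) \<le> 2 * (e * fst (\<Psi> (t, H l t)) - e * fst (\<Psi> (u, z0 u)))"
      using step[OF inW l, of u t] t by (simp add: Hu)
    have 2: "norm (snd (\<Psi> (v, z0 v)) - snd (\<Psi> (t, H l t))) \<le> 2 * (e * fst (\<Psi> (v, z0 v)) - e * fst (\<Psi> (t, H l t)))"
      using step[OF inW l, of t v] t by (simp add: Hv)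
    have "0 \<le> e * fst (\<Psi> (t, H l t)) - e * fst (\<Psi> (u, z0 u))" "0 \<le> e * fst (\<Psi> (v, z0 v)) - e * fst (\<Psi> (t, H l t))"
      using order_trans[OF norm_ge_zero 1] order_trans[OF norm_ge_zero 2] by simp_all
    then have 3: "\<bar>fst (\<Psi> (t, H l t))\<bar> \<le> \<rho> / 6" "e * fst (\<Psi> (t, H l t)) - e * fst (\<Psi> (u, z0 u)) \<le> \<rho> / 3"
      using ends_small e by auto
    have "norm (snd (\<Psi> (t, H l t))) \<le> 5 * \<rho> / 6"
      using order_trans[OF 1 mult_left_mono[OF 3(2), of 2]] ends_small(3) norm_triangle_sub[of "snd (\<Psi> (t, H l t))" "snd (\<Psi> (u, z0 u))"] by linarith
    then show ?thesis
      using 3(1) norm_Pair_le[of "fst (\<Psi> (t, H l t))" "snd (\<Psi> (t, H l t))"] by simp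
  qed
  define \<Lambda> where "\<Lambda> = {l \<in> {0..1}. \<forall>t\<in>{u..v}. (t, H l t) \<in> W}"
  have Hc2: "continuous_on ({0..1} \<times> {u..v}) (\<lambda>(l, t). (t, H l t))"
    unfolding H_def case_prod_unfold
    by (intro continuous_intros continuous_on_compose2[OF c(1)] continuous_on_compose2[OF c(2)]) auto
  \<comment> \<open>The pairs \<open>(l, t)\<close> whose point lies outside \<open>W\<close> form a
    compact set, so their projection to \<open>l\<close> is closed.\<close>
  have "closedin (top_of_set {0..1}) ({0..1} - \<Lambda>)"
  proof -
    have "closedin (top_of_set ({0..1} \<times> {u..v})) (({0..1} \<times> {u..v}) \<inter> (\<lambda>(l, t). (t, H l t)) -` (- W))"
      using Hc2 W_open by (intro continuous_closedin_preimage) auto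
    then have "compact (({0..1} \<times> {u..v}) \<inter> (\<lambda>(l, t). (t, H l t)) -` (- W))"
      by (rule closedin_compact[OF compact_Times[OF compact_Icc compact_Icc]])
    then have "compact (fst ` (({0..1} \<times> {u..v}) \<inter> (\<lambda>(l, t). (t, H l t)) -` (- W)))"
      by (intro compact_continuous_image continuous_intros)
    moreover have "fst ` (({0..1} \<times> {u..v}) \<inter> (\<lambda>(l, t). (t, H l t)) -` (- W)) = {0..1} - \<Lambda>"
    proof (intro equalityI subsetI)
      fix l assume "l \<in> {0..1} - \<Lambda>"
      then obtain t where "l \<in> {0..1}" "t \<in> {u..v}" "(t, H l t) \<notin> W" by (auto simp: \<Lambda>_def)
      then show "l \<in> fst ` (({0..1} \<times> {u..v}) \<inter> (\<lambda>(l, t). (t, H l t)) -` (- W))"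
        by (intro image_eqI[of _ _ "(l, t)"]) auto
    qed (auto simp: \<Lambda>_def)
    ultimately show ?thesis
      by (metis Diff_subset closed_subset compact_imp_closed)
  qed
  then have 1: "openin (top_of_set {0..1}) \<Lambda>"
    by (simp add: openin_closedin_eq) (auto simp: \<Lambda>_def)
  \<comment> \<open>By \<open>confine\<close>, a curve contained in \<open>W\<close> lies in the
    smaller region where the norm is at most \<open>\<rho>\<close>. That region is closed in
    \<open>kasner_M\<close>, so each \<open>t\<close> imposes a closed condition on
    \<open>l\<close>.\<close>
  have 2: "closedin (top_of_set {0..1}) \<Lambda>"
  proof -
    have eq: "\<Lambda> = (\<Inter>t\<in>{u..v}. {0..1} \<inter> (\<lambda>l. (t, H l t)) -` {q \<in> W. norm (\<Psi> q) \<le> \<rho>})"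
    proof (intro equalityI subsetI)
      fix l assume "l \<in> \<Lambda>"
      then have "l \<in> {0..1}" "\<And>t. u \<le> t \<Longrightarrow> t \<le> v \<Longrightarrow> (t, H l t) \<in> W"
        by (auto simp: \<Lambda>_def)
      then show "l \<in> (\<Inter>t\<in>{u..v}. {0..1} \<inter> (\<lambda>l. (t, H l t)) -` {q \<in> W. norm (\<Psi> q) \<le> \<rho>})"
        using confine[of l] by auto
    qed (use um in \<open>auto simp: \<Lambda>_def\<close>)
    have "closedin (top_of_set {0..1}) ({0..1} \<inter> (\<lambda>l. (t, H l t)) -` {q \<in> W. norm (\<Psi> q) \<le> \<rho>})"
      if "t \<in> {u..v}" for t
    proof (rule continuous_closedin_preimage_gen[OF _ _ closed])
      show "continuous_on {0..1} (\<lambda>l. (t, H l t))" unfolding H_def by (intro continuous_intros)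
      show "(\<lambda>l. (t, H l t)) \<in> {0..1} \<rightarrow> kasner_M" using that um by (auto simp: kasner_M_def)
    qed
    then show ?thesis unfolding eq using um by (intro closedin_INT) auto
  qed
  have "0 \<in> \<Lambda>" using z0W by (auto simp: \<Lambda>_def H_def)
  moreover have "connected {0..1::real}" by simp
  ultimately have "\<Lambda> = {0..1}" using 1 2 unfolding connected_clopen by blast
  then have "1 \<in> \<Lambda>" by simp
  then have z1W: "(t, H 1 t) \<in> W" if "u \<le> t" "t \<le> v" for t
    using that by (auto simp: \<Lambda>_def)
  have pc: "sqrt \<eta> * (t - s) \<le> 2 * (e * fst (\<Psi> (t, H 1 t)) - e * fst (\<Psi> (s, H 1 s)))"
      if "u \<le> s" "s \<le> t" "t \<le> v" "t \<le> m \<or> m \<le> s" for s t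
  proof (rule segment_length[where z' = z1'])
    fix r assume "s < r" "r < t"
    then have r: "u < r" "r < v" "r \<noteq> m" using that by auto
    show "(H 1 has_vector_derivative z1' r) (at r)" using Hd[OF r, of 1] by (simp add: H'_def)
    show "spatial_sq P r (z1' r) < 1" "spatial_sq P r (z1' r) \<le> 1 - \<eta>" using t1[OF r] eta(1)[OF r] by auto
  qed (use that eta(2) in \<open>auto intro!: continuous_on_subset[OF Hc] pos z1W e\<close>)
  have "sqrt \<eta> * (v - u) \<le> 2 * (e * fst (\<Psi> (v, z0 v)) - e * fst (\<Psi> (u, z0 u)))"
    using pc[of u m] pc[of m v] um by (simp add: Hu Hv algebra_simps)
  also have "\<dots> \<le> \<rho>" using ends_small e by auto
  finally show ?thesis .
qed

section \<open>The long comparison curve\<close>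

text \<open>The graph of \<open>x\<close> up to time \<open>v\<close> serves as the known curve. A
  competitor from \<open>(a', x a)\<close> to \<open>(v, x v)\<close> has length at least of order
  \<open>v powr ((1 - k) / 2)\<close>, against the bound \<open>\<rho>\<close> of
  \<open>homotopy_length_bound\<close>, which does not depend on \<open>v\<close>.\<close>

lemma no_escape:
  assumes k: "0 \<le> k" "k < 1" "\<And>i. - k \<le> P $ i" and rho: "0 < \<rho>" and t0: "0 \<le> t0"
    and xd: "\<And>t. t0 < t \<Longrightarrow> (x has_vector_derivative x' t) (at t)"
    and xt: "\<And>t. t0 < t \<Longrightarrow> spatial_sq P t (x' t) < 1"
    and xW: "\<And>t. t0 < t \<Longrightarrow> (t, x t) \<in> W"
    and small: "\<And>t. t0 < t \<Longrightarrow> norm (\<Psi> (t, x t)) < \<rho> / 6"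
  shows False
proof -
  define a where "a = t0 + 1"
  have a: "t0 < a" "0 < a" using t0 by (auto simp: a_def)
  have xc: "continuous_on {a..} x"
    by (intro continuous_at_imp_continuous_on ballI has_vector_derivative_continuous[OF xd])
       (use a in auto)
  \<comment> \<open>\<open>W\<close> is open and \<open>\<Psi>\<close> continuous, so a short
    vertical segment below \<open>(a, x a)\<close> stays in \<open>W\<close> with small norm. The
    head start from \<open>a'\<close> to \<open>a\<close> is what pays for slowing the competitor
    down.\<close>
  have lim: "((\<lambda>t. (t, x a)) \<longlongrightarrow> (a, x a)) (at_left a)"
    by (intro tendsto_intros)
  have "\<forall>\<^sub>F t in at_left a. (t, x a) \<in> W"
    using topological_tendstoD[OF lim W_open] xW a by auto
  moreover have "\<forall>\<^sub>F t in at_left a. norm (\<Psi> (t, x a)) < \<rho> / 6"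
  proof -
    have "((\<lambda>t. norm (\<Psi> (t, x a))) \<longlongrightarrow> norm (\<Psi> (a, x a))) (at_left a)"
      using deriv[OF xW[OF a(1)]] has_derivative_continuous
      by (intro tendsto_norm isCont_tendsto_compose[OF _ lim]) blast
    then show ?thesis using small[OF a(1)] by (rule order_tendstoD)
  qed
  ultimately have "\<forall>\<^sub>F t in at_left a. (t, x a) \<in> W \<and> norm (\<Psi> (t, x a)) < \<rho> / 6"
    by (rule eventually_conj)
  then obtain b where b: "b < a" "\<And>t. b < t \<Longrightarrow> t < a \<Longrightarrow> (t, x a) \<in> W \<and> norm (\<Psi> (t, x a)) < \<rho> / 6"
    unfolding eventually_at_left_field by blast
  define a' where "a' = (max b t0 + a) / 2"
  have a': "b < a'" "a' < a" "0 < a'" using b(1) a t0 by (auto simp: a'_def)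
  define K where "K = 1 + k"
  have K: "1 \<le> K" "K < 2" using k by (auto simp: K_def)
  define A where "A = a powr K - a' powr K"
  have A: "0 < A" using a' K by (auto simp: A_def intro!: powr_less_mono2)
  have bound: "sqrt (A / (v powr K - a' powr K)) * (v - a') \<le> \<rho>" if v: "a < v" for v
  proof -
    define D where "D = v powr K - a' powr K"
    have av: "a powr K < v powr K" using v a K by (auto intro!: powr_less_mono2)
    have D: "0 < D" "A < D" using A av by (auto simp: D_def A_def)
    \<comment> \<open>This \<open>e\<close> makes \<open>S a' = a powr K\<close>, so
      \<open>\<sigma> a' = a\<close>, while \<open>\<sigma> v = v\<close> holds for any
      \<open>e\<close>. Differentiating \<open>\<sigma> t powr K = S t\<close> yields the speed
      \<open>(1 - e) * (t / \<sigma> t) powr k\<close>, exactly the shape that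
      \<open>spatial_sq_delay\<close> handles.\<close>
    define e where "e = A / D"
    have e: "0 < e" "e < 1" using A D by (auto simp: e_def)
    define S where "S t = (1 - e) * t powr K + e * v powr K" for t
    define \<sigma> where "\<sigma> t = S t powr (1 / K)" for t
    have Sa': "S a' = a powr K"
    proof -
      have "S a' = a' powr K + e * D" by (simp add: S_def D_def algebra_simps)
      also have "e * D = A" using D by (simp add: e_def)
      finally show ?thesis by (simp add: A_def)
    qed
    have Sv: "S v = v powr K" by (simp add: S_def algebra_simps)
    have Slow: "t powr K \<le> S t" if "0 < t" "t \<le> v" for t
    proof -
      have "t powr K \<le> v powr K" using that K by (intro powr_mono2) auto
      then have "0 \<le> e * (v powr K - t powr K)" using e by simp
      then show ?thesis by (simp add: S_def algebra_simps)
    qed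
    have Smono: "S s < S t" if "0 < s" "s < t" for s t
      using that e K by (auto simp: S_def intro!: powr_less_mono2)
    have root: "(s powr K) powr (1 / K) = s" if "0 < s" for s
      using that K by (simp add: powr_powr)
    have sa': "\<sigma> a' = a" and sv: "\<sigma> v = v"
      using a a' v by (auto simp: \<sigma>_def Sa' Sv root)
    have Spos: "0 < S t" if "0 < t" "t \<le> v" for t
      using Slow[OF that] that by (smt (verit) powr_gt_zero)
    have slow: "t \<le> \<sigma> t" if "0 < t" "t \<le> v" for t
      using powr_mono2[OF _ _ Slow[OF that], of "1 / K"] root[OF that(1)] K by (simp add: \<sigma>_def)
    have smono: "\<sigma> s < \<sigma> t" if "0 < s" "s < t" "t \<le> v" for s t
      using Smono[OF that(1,2)] Spos[of s] that K by (auto simp: \<sigma>_def intro!: powr_less_mono2)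
    have sder: "(\<sigma> has_real_derivative (1 - e) * (t / \<sigma> t) powr k) (at t)" if t: "0 < t" "t \<le> v" for t
    proof -
      have Sd: "(S has_real_derivative (1 - e) * (K * t powr (K - 1))) (at t)"
        unfolding S_def using t by (auto intro!: derivative_eq_intros)
      have "(\<sigma> has_real_derivative (1 / K) * S t powr (1 / K - 1) * ((1 - e) * (K * t powr (K - 1)))) (at t)"
        unfolding \<sigma>_def by (rule DERIV_fun_powr[OF Sd Spos[OF t], THEN DERIV_cong]) simp
      moreover have "S t powr (1 / K - 1) = \<sigma> t powr (- k)"
        using K by (simp add: \<sigma>_def powr_powr K_def field_simps)
      moreover have "\<sigma> t powr (- k) * t powr k = (t / \<sigma> t) powr k"
        using t slow[OF t] by (simp add: powr_divide powr_minus field_simps)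
      ultimately show ?thesis using K by (simp add: K_def mult_ac)
    qed
    \<comment> \<open>\<open>z0\<close> waits at \<open>x a\<close> until time \<open>a\<close>, its
      kink, and then follows \<open>x\<close>; \<open>z1\<close> runs ahead of it along
      \<open>x\<close> and is met again at time \<open>v\<close>.\<close>
    define z0 where "z0 t = x (max t a)" for t
    define z0' where "z0' t = (if t < a then 0 else x' t)" for t
    define z1 where "z1 t = x (\<sigma> t)" for t
    define z1' where "z1' t = ((1 - e) * (t / \<sigma> t) powr k) *\<^sub>R x' (\<sigma> t)" for t
    have sin: "a < \<sigma> t" "\<sigma> t < v" if "a' < t" "t < v" for t
      using smono[of a' t] smono[of t v] that a' by (auto simp: sa' sv)
    have ks: "spatial_sq P t (z1' t) \<le> (1 - e)\<^sup>2" if "a' < t" "t < v" for t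
    proof -
      have "spatial_sq P t (z1' t) \<le> (1 - e)\<^sup>2 * spatial_sq P (\<sigma> t) (x' (\<sigma> t))"
        unfolding z1'_def using that a' slow[of t] k by (intro spatial_sq_delay) auto
      also have "\<dots> \<le> (1 - e)\<^sup>2"
        using xt[of "\<sigma> t"] sin[OF that] a by (intro mult_left_le) auto
      finally show ?thesis .
    qed
    \<comment> \<open>The uniform slow-down thus leaves a gap of at least \<open>e\<close> below the
      light cone, which serves as \<open>\<eta>\<close>.\<close>
    have e2: "(1 - e)\<^sup>2 \<le> 1 - e" using e by (simp add: power2_eq_square mult_left_le)
    have "sqrt e * (v - a') \<le> \<rho>"
    proof (rule homotopy_length_bound[of a' a v z0 z1 z0' z1'])
      show "continuous_on {a'..v} z0"
        unfolding z0_def by (rule continuous_on_compose2[OF xc]) (auto intro!: continuous_intros)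
      have "continuous_on {a'..v} \<sigma>"
        by (intro continuous_at_imp_continuous_on ballI DERIV_isCont[OF sder]) (use a' in auto)
      moreover have "a \<le> \<sigma> t" if "a' \<le> t" "t \<le> v" for t
        using smono[of a' t] that a' by (cases "t = a'") (auto simp: sa')
      ultimately show "continuous_on {a'..v} z1"
        unfolding z1_def by (intro continuous_on_compose2[OF xc]) auto
      fix t assume t: "a' < t" "t < v" "t \<noteq> a"
      show "(z0 has_vector_derivative z0' t) (at t)"
      proof (cases "t < a")
        case True
        have "((\<lambda>t. x a) has_vector_derivative 0) (at t)" by simp
        then show ?thesis
          by (rule has_vector_derivative_transform_within_open[of _ _ _ "{..<a}", THEN has_vector_derivative_eq_rhs])
             (use True in \<open>auto simp: z0_def z0'_def\<close>)
      next
        case False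
        then have "(x has_vector_derivative x' t) (at t)" using xd a by auto
        then show ?thesis
          by (rule has_vector_derivative_transform_within_open[of _ _ _ "{a<..}", THEN has_vector_derivative_eq_rhs])
             (use False t in \<open>auto simp: z0_def z0'_def\<close>)
      qed
      show "(z1 has_vector_derivative z1' t) (at t)"
      proof -
        have "(\<sigma> has_vector_derivative (1 - e) * (t / \<sigma> t) powr k) (at t)"
          using sder[of t] t a' by (simp add: has_real_derivative_iff_has_vector_derivative)
        from vector_diff_chain_at[OF this, of x "x' (\<sigma> t)"] xd[of "\<sigma> t"] sin[OF t(1,2)] a
        show ?thesis unfolding z1_def z1'_def by (simp add: o_def)
      qed
      show "spatial_sq P t (z0' t) < 1" using xt[of t] a t by (auto simp: z0'_def)
      show "spatial_sq P t (z1' t) < 1" "spatial_sq P t (z1' t) \<le> 1 - e" using ks[OF t(1,2)] e2 e by auto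
    next
      fix t assume t: "a' \<le> t" "t \<le> v"
      show "(t, z0 t) \<in> W"
        using b(2)[of t] xW[of t] t a a' by (cases "t < a") (auto simp: z0_def max_def)
    qed (use a' v e small[of v] b(2)[of a'] a in \<open>auto simp: z0_def z1_def sa' sv max_def\<close>)
    then show ?thesis by (simp add: e_def D_def)
  qed
  \<comment> \<open>As \<open>v \<ge> 2 * a\<close> gives \<open>v - a' \<ge> v / 2\<close>, the
    bound amounts to \<open>A * v powr (2 - K) \<le> 4 * \<rho>\<^sup>2\<close>. The choice of
    \<open>v\<close> makes the left side at least \<open>A * B\<close>, which exceeds the right side
    by \<open>A\<close>.\<close>
  define B where "B = 4 * \<rho>\<^sup>2 / A + 1"
  have B: "0 < B" using A by (auto simp: B_def intro: add_nonneg_pos)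
  define v where "v = max (2 * a) (B powr (1 / (2 - K)))"
  have v: "2 * a \<le> v" "a < v" "0 < v" "B powr (1 / (2 - K)) \<le> v" using a by (auto simp: v_def)
  have "B \<le> v powr (2 - K)"
    using powr_mono2[OF _ _ v(4), of "2 - K"] K B by (simp add: powr_powr)
  have pv: "0 < v powr K - a' powr K" using a' v K by (auto intro!: powr_less_mono2)
  have "(sqrt (A / (v powr K - a' powr K)) * (v - a'))\<^sup>2 \<le> \<rho>\<^sup>2"
    by (rule power_mono[OF bound[OF v(2)]]) (use A pv v a' in auto)
  then have "A * (v - a')\<^sup>2 / (v powr K - a' powr K) \<le> \<rho>\<^sup>2"
    using A pv by (simp add: power_mult_distrib)
  then have "A * (v - a')\<^sup>2 \<le> \<rho>\<^sup>2 * (v powr K - a' powr K)"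
    using pv by (simp add: field_simps)
  also have "\<dots> \<le> \<rho>\<^sup>2 * v powr K"
    by (intro mult_left_mono) auto
  finally have 1: "A * (v - a')\<^sup>2 \<le> \<rho>\<^sup>2 * v powr K" .
  have "(v / 2)\<^sup>2 \<le> (v - a')\<^sup>2" using v a' by (intro power_mono) auto
  then have "A * (v / 2)\<^sup>2 \<le> \<rho>\<^sup>2 * v powr K"
    using 1 A by (meson less_imp_le mult_left_mono order_trans)
  moreover have "v\<^sup>2 = v powr (2 - K) * v powr K"
    using v by (simp flip: powr_add)
  ultimately have "A * v powr (2 - K) / 4 * v powr K \<le> \<rho>\<^sup>2 * v powr K"
    by (simp add: power_divide)
  then have "A * v powr (2 - K) / 4 \<le> \<rho>\<^sup>2" using v by simp
  moreover have "A * B \<le> A * v powr (2 - K)" using A \<open>B \<le> _\<close> by simp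
  moreover have "A * B = 4 * \<rho>\<^sup>2 + A" using A by (simp add: B_def field_simps)
  ultimately show False using A by linarith
qed

end

section \<open>Charts of an extension\<close>

text \<open>\<open>lorentz_form\<close> only provides a linear bijection \<open>L\<close> to the
  Minkowski form; bilinearity is recovered by evaluating that form at \<open>inv L v\<close> and
  \<open>inv L w\<close>.\<close>

lemma bilinear_lorentz_form:
  fixes B :: "'d::finite spt \<Rightarrow> 'd spt \<Rightarrow> real"
  assumes "lorentz_form B"
  shows "bilinear B"
proof -
  obtain L :: "'d spt \<Rightarrow> 'd spt" where L: "linear L" "bij L" "\<forall>v w. B (L v) (L w) = minkowski v w"
    using assms unfolding lorentz_form_def by blast
  interpret J: linear "inv L"
    using L(1,2) by (simp add: eucl.inj_linear_imp_inv_linear bij_is_inj)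
  have B: "B v w = minkowski (inv L v) (inv L w)" for v w
    using L(2,3) by (metis bij_inv_eq_iff)
  show ?thesis
    unfolding bilinear_def B minkowski_def
    by (intro conjI allI linearI)
       (simp_all only: J.add J.scale fst_add snd_add fst_scaleR snd_scaleR inner_add_left inner_add_right
          inner_scaleR_left inner_scaleR_right real_scaleR_def algebra_simps)
qed

text \<open>Continuity is assumed only for each fixed pair of vectors. Expansion in the finite basis
  makes it uniform in \<open>v\<close>: each of the \<open>n\<close> matrix entries varies by at
  most \<open>e / n\<close>, and coordinates are bounded by the norm.\<close>

lemma bilinear_forms_close:
  fixes B :: "'a::euclidean_space \<Rightarrow> 'c::euclidean_space \<Rightarrow> 'c \<Rightarrow> real"
  assumes "open S" "y0 \<in> S" and bil: "\<And>y. y \<in> S \<Longrightarrow> bilinear (B y)"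
    and cont: "\<And>v w. continuous_on S (\<lambda>y. B y v w)" and "0 < e"
  shows "\<exists>r>0. ball y0 r \<subseteq> S \<and> (\<forall>y\<in>ball y0 r. \<forall>v. \<bar>B y v v - B y0 v v\<bar> \<le> e * (norm v)\<^sup>2)"
proof -
  define n where "n = real (card (Basis \<times> Basis :: ('c \<times> 'c) set))"
  have n: "0 < n" unfolding n_def by (simp add: card_gt_0_iff)
  have "\<forall>\<^sub>F y in nhds y0. \<bar>B y v w - B y0 v w\<bar> < e / n" for v w
  proof -
    have "((\<lambda>y. B y v w) \<longlongrightarrow> B y0 v w) (nhds y0)"
      using cont assms(1,2) continuous_on_eq_continuous_at continuous_at tendsto_at_iff_tendsto_nhds by metis
    from tendstoD[OF this, of "e / n"] show ?thesis
      using n \<open>0 < e\<close> by (simp add: dist_real_def)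
  qed
  then have "\<forall>\<^sub>F y in nhds y0. \<forall>b\<in>Basis \<times> Basis. \<bar>B y (fst b) (snd b) - B y0 (fst b) (snd b)\<bar> < e / n"
    by (intro eventually_ball_finite) auto
  moreover have "\<forall>\<^sub>F y in nhds y0. y \<in> S"
    using assms(1,2) by (rule eventually_nhds_in_open)
  ultimately have "\<forall>\<^sub>F y in nhds y0. y \<in> S \<and>
      (\<forall>b\<in>Basis \<times> Basis. \<bar>B y (fst b) (snd b) - B y0 (fst b) (snd b)\<bar> < e / n)"
    by (rule eventually_conj[rotated])
  then obtain r where r: "0 < r" "\<And>y. dist y y0 < r \<Longrightarrow> y \<in> S \<and>
      (\<forall>b\<in>Basis \<times> Basis. \<bar>B y (fst b) (snd b) - B y0 (fst b) (snd b)\<bar> < e / n)"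
    unfolding eventually_nhds_metric by blast
  have expand: "B y v v = (\<Sum>b\<in>Basis \<times> Basis. (v \<bullet> fst b) * (v \<bullet> snd b) * B y (fst b) (snd b))"
    if "y \<in> S" for y v
  proof -
    have "B y v v = B y (\<Sum>b\<in>Basis. (v \<bullet> b) *\<^sub>R b) (\<Sum>b\<in>Basis. (v \<bullet> b) *\<^sub>R b)"
      by (simp add: euclidean_representation)
    also have "\<dots> = (\<Sum>(i, j)\<in>Basis \<times> Basis. B y ((v \<bullet> i) *\<^sub>R i) ((v \<bullet> j) *\<^sub>R j))"
      by (rule bilinear_sum[OF bil[OF that]])
    also have "\<dots> = (\<Sum>b\<in>Basis \<times> Basis. (v \<bullet> fst b) * (v \<bullet> snd b) * B y (fst b) (snd b))"
      by (intro sum.cong refl)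
         (auto simp: bilinear_lmul[OF bil[OF that]] bilinear_rmul[OF bil[OF that]])
    finally show ?thesis .
  qed
  show ?thesis
  proof (intro exI[of _ r] conjI ballI allI)
    show "0 < r" by fact
    show "ball y0 r \<subseteq> S" using r(2) by (auto simp: dist_commute)
    fix y v assume "y \<in> ball y0 r"
    then have y: "y \<in> S" "\<And>b. b \<in> Basis \<times> Basis \<Longrightarrow> \<bar>B y (fst b) (snd b) - B y0 (fst b) (snd b)\<bar> \<le> e / n"
      using r(2)[of y] by (auto simp: dist_commute less_imp_le)
    have "B y v v - B y0 v v
        = (\<Sum>b\<in>Basis \<times> Basis. (v \<bullet> fst b) * (v \<bullet> snd b) * (B y (fst b) (snd b) - B y0 (fst b) (snd b)))"
      by (simp add: expand y(1) assms(2) right_diff_distrib sum_subtractf)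
    also have "\<bar>\<dots>\<bar> \<le> (\<Sum>b\<in>(Basis \<times> Basis :: ('c \<times> 'c) set). (norm v)\<^sup>2 * (e / n))"
    proof (rule order_trans[OF sum_abs sum_mono])
      fix b :: "'c \<times> 'c" assume b: "b \<in> Basis \<times> Basis"
      have "\<bar>v \<bullet> fst b\<bar> * \<bar>v \<bullet> snd b\<bar> * \<bar>B y (fst b) (snd b) - B y0 (fst b) (snd b)\<bar>
          \<le> norm v * norm v * (e / n)"
        using b by (intro mult_mono y(2) Basis_le_norm) auto
      then show "\<bar>(v \<bullet> fst b) * (v \<bullet> snd b) * (B y (fst b) (snd b) - B y0 (fst b) (snd b))\<bar>
          \<le> (norm v)\<^sup>2 * (e / n)"
        by (simp add: abs_mult power2_eq_square)
    qed
    also have "\<dots> = e * (norm v)\<^sup>2"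
      using n by (simp add: n_def)
    finally show "\<bar>B y v v - B y0 v v\<bar> \<le> e * (norm v)\<^sup>2" .
  qed
qed

section \<open>Local consequences of the extension axioms\<close>

lemma open_kasner_M: "open (kasner_M :: 'd::finite spt set)"
  unfolding kasner_M_def by (intro open_Collect_less continuous_intros)

lemma ball_pair_iff: "(\<forall>(x, y)\<in>A. Q x y) \<longleftrightarrow> (\<forall>x y. (x, y) \<in> A \<longrightarrow> Q x y)"
  by auto

lemma C0_extensionD:
  assumes "C0_extension P X A G \<iota>"
  shows C0_extension_Hausdorff: "Hausdorff_space X"
    and C0_extension_chart: "p \<in> topspace X \<Longrightarrow> \<exists>U \<phi>. (U, \<phi>) \<in> A \<and> p \<in> U"
    and C0_extension_openin: "(U, \<phi>) \<in> A \<Longrightarrow> openin X U"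
    and C0_extension_open: "(U, \<phi>) \<in> A \<Longrightarrow> open (\<phi> ` U)"
    and C0_extension_homeo: "(U, \<phi>) \<in> A \<Longrightarrow> homeomorphic_map (subtopology X U) (top_of_set (\<phi> ` U)) \<phi>"
    and C0_extension_form: "(U, \<phi>) \<in> A \<Longrightarrow> y \<in> \<phi> ` U \<Longrightarrow> lorentz_form (G (U, \<phi>) y)"
    and C0_extension_continuous: "(U, \<phi>) \<in> A \<Longrightarrow> continuous_on (\<phi> ` U) (\<lambda>y. G (U, \<phi>) y v w)"
    and C0_extension_map: "continuous_map (top_of_set kasner_M) X \<iota>"
    and C0_extension_smooth: "(U, \<phi>) \<in> A \<Longrightarrow> smooth_on (kasner_M \<inter> \<iota> -` U) (\<phi> \<circ> \<iota>)"
    and C0_extension_inj: "inj_on \<iota> kasner_M"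
    and C0_extension_isometric: "(U, \<phi>) \<in> A \<Longrightarrow> q \<in> kasner_M \<Longrightarrow> \<iota> q \<in> U \<Longrightarrow>
      G (U, \<phi>) (\<phi> (\<iota> q)) (frechet_derivative (\<phi> \<circ> \<iota>) (at q) v) (frechet_derivative (\<phi> \<circ> \<iota>) (at q) w)
        = kasner_g P q v w"
proof -
  note x = assms[unfolded C0_extension_def ball_pair_iff]
  note m = x[THEN conjunct1, unfolded C0_lorentzian_manifold_def ball_pair_iff]
  note S = x[THEN conjunct2, THEN conjunct1]
  note I = x[THEN conjunct2, THEN conjunct2]
  note iso = I[THEN conjunct2, THEN conjunct2, THEN conjunct1]
  show "Hausdorff_space X" by (rule m[THEN conjunct1])
  show "p \<in> topspace X \<Longrightarrow> \<exists>U \<phi>. (U, \<phi>) \<in> A \<and> p \<in> U"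
    using m[THEN conjunct2, THEN conjunct2, THEN conjunct1] by fast
  note c = m[THEN conjunct2, THEN conjunct2, THEN conjunct2]
  show "(U, \<phi>) \<in> A \<Longrightarrow> openin X U" "(U, \<phi>) \<in> A \<Longrightarrow> open (\<phi> ` U)"
    "(U, \<phi>) \<in> A \<Longrightarrow> homeomorphic_map (subtopology X U) (top_of_set (\<phi> ` U)) \<phi>"
    using c[THEN conjunct1] by simp_all
  show "(U, \<phi>) \<in> A \<Longrightarrow> y \<in> \<phi> ` U \<Longrightarrow> lorentz_form (G (U, \<phi>) y)"
    using c[THEN conjunct2, THEN conjunct2, THEN conjunct1] by blast
  show "(U, \<phi>) \<in> A \<Longrightarrow> continuous_on (\<phi> ` U) (\<lambda>y. G (U, \<phi>) y v w)"
    using c[THEN conjunct2, THEN conjunct2, THEN conjunct2, THEN conjunct1] by blast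
  show "continuous_map (top_of_set kasner_M) X \<iota>"
    "(U, \<phi>) \<in> A \<Longrightarrow> smooth_on (kasner_M \<inter> \<iota> -` U) (\<phi> \<circ> \<iota>)"
    using S unfolding smooth_map_into_def ball_pair_iff by blast+
  show "inj_on \<iota> kasner_M" by (rule I[THEN conjunct1])
  show "(U, \<phi>) \<in> A \<Longrightarrow> q \<in> kasner_M \<Longrightarrow> \<iota> q \<in> U \<Longrightarrow>
      G (U, \<phi>) (\<phi> (\<iota> q)) (frechet_derivative (\<phi> \<circ> \<iota>) (at q) v) (frechet_derivative (\<phi> \<circ> \<iota>) (at q) w)
        = kasner_g P q v w"
    using iso by blast
qed

lemma C0_extension_chart_map:
  fixes \<iota> :: "'d::finite spt \<Rightarrow> 'b"
  assumes ext: "C0_extension P X A G \<iota>" and U: "(U, \<phi>) \<in> A"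
  shows C0_extension_open_preimage: "open (kasner_M \<inter> \<iota> -` U)"
    and C0_extension_chart_derivative: "q \<in> kasner_M \<inter> \<iota> -` U \<Longrightarrow>
        ((\<phi> \<circ> \<iota>) has_derivative frechet_derivative (\<phi> \<circ> \<iota>) (at q)) (at q)"
    and C0_extension_continuous_derivative:
      "continuous_on (kasner_M \<inter> \<iota> -` U) (\<lambda>q. frechet_derivative (\<phi> \<circ> \<iota>) (at q) v)"
proof -
  have "openin (top_of_set kasner_M) (kasner_M \<inter> \<iota> -` U)"
    using openin_continuous_map_preimage[OF C0_extension_map[OF ext] C0_extension_openin[OF ext U]]
    by (simp add: Int_def vimage_def)
  then show "open (kasner_M \<inter> \<iota> -` U)"
    by (simp add: openin_open_eq open_kasner_M)
  have sm: "iter_dderiv vs (\<phi> \<circ> \<iota>) differentiable (at q)" if "q \<in> kasner_M \<inter> \<iota> -` U" for vs q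
    using C0_extension_smooth[OF ext U] that unfolding smooth_on_def by blast
  show "((\<phi> \<circ> \<iota>) has_derivative frechet_derivative (\<phi> \<circ> \<iota>) (at q)) (at q)" if "q \<in> kasner_M \<inter> \<iota> -` U"
    using sm[OF that, of "[]"] by (simp add: frechet_derivative_works)
  \<comment> \<open>\<open>iter_dderiv [v]\<close> gives the derivative in direction
    \<open>v\<close>; smoothness makes it differentiable, hence continuous.\<close>
  show "continuous_on (kasner_M \<inter> \<iota> -` U) (\<lambda>q. frechet_derivative (\<phi> \<circ> \<iota>) (at q) v)"
    using sm[of _ "[v]"]
    by (intro continuous_at_imp_continuous_on ballI) (auto intro!: differentiable_imp_continuous_within)
qed

text \<open>Both manifolds have the same dimension, so invariance of domain applies to
  \<open>\<phi> \<circ> \<iota>\<close> near each point, and the chart homeomorphism carries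
  openness back to \<open>X\<close>.\<close>

lemma C0_extension_openin_image:
  fixes \<iota> :: "'d::finite spt \<Rightarrow> 'b"
  assumes ext: "C0_extension P X A G \<iota>"
  shows "openin X (\<iota> ` kasner_M)"
proof (subst openin_subopen, intro ballI)
  fix p assume "p \<in> \<iota> ` kasner_M"
  then obtain q where q: "q \<in> kasner_M" "p = \<iota> q" by blast
  have "p \<in> topspace X"
    using C0_extension_map[OF ext] q by (auto simp: continuous_map_def)
  then obtain U \<phi> where U: "(U, \<phi>) \<in> A" "p \<in> U" using C0_extension_chart[OF ext] by blast
  define V where "V = kasner_M \<inter> \<iota> -` U"
  have "continuous_on V (\<phi> \<circ> \<iota>)"
    unfolding V_def
    by (intro continuous_at_imp_continuous_on ballI has_derivative_continuous[OF C0_extension_chart_derivative[OF ext U(1)]])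
  moreover have "inj_on \<phi> U"
    using homeomorphic_imp_injective_map[OF C0_extension_homeo[OF ext U(1)]]
      openin_subset[OF C0_extension_openin[OF ext U(1)]] by (simp add: Int_absorb1)
  then have "inj_on (\<phi> \<circ> \<iota>) V"
    using C0_extension_inj[OF ext] unfolding V_def
    by (intro comp_inj_on) (auto intro: inj_on_subset)
  ultimately have "open ((\<phi> \<circ> \<iota>) ` V)"
    using C0_extension_open_preimage[OF ext U(1)] unfolding V_def by (intro invariance_of_domain)
  then have "openin (top_of_set (\<phi> ` U)) (\<phi> ` (\<iota> ` V))"
    unfolding image_comp by (rule open_subset[rotated]) (auto simp: V_def)
  then have "openin (subtopology X U) (\<iota> ` V)"
    using homeomorphic_map_openness[OF C0_extension_homeo[OF ext U(1)], of "\<iota> ` V"]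
      openin_subset[OF C0_extension_openin[OF ext U(1)]] by (auto simp: V_def)
  then have "openin X (\<iota> ` V)"
    using C0_extension_openin[OF ext U(1)] by (meson openin_open_subtopology)
  then show "\<exists>T. openin X T \<and> p \<in> T \<and> T \<subseteq> \<iota> ` kasner_M"
    using q U(2) by (intro exI[of _ "\<iota> ` V"]) (auto simp: V_def)
qed

section \<open>Construction of a nearly Minkowskian chart\<close>

text \<open>Linear coordinates centred at \<open>p\<close> turn the metric at \<open>p\<close> into
  the Minkowski form, and continuity keeps it close to that nearby. \<open>N\<close> is the ball of
  radius \<open>\<rho> / 6\<close> in which the ends of a homotopy must lie.\<close>

lemma C0_extension_kasner_chart:
  fixes \<iota> :: "'d::finite spt \<Rightarrow> 'b"
  assumes ext: "C0_extension P X A G \<iota>" and p: "p \<in> topspace X"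
  obtains W \<Psi> \<Psi>' \<rho> N where "kasner_chart P W \<Psi> \<Psi>' \<rho>" "0 < \<rho>" "openin X N" "p \<in> N"
    "\<And>q. q \<in> kasner_M \<Longrightarrow> \<iota> q \<in> N \<Longrightarrow> q \<in> W \<and> norm (\<Psi> q) < \<rho> / 6"
proof -
  obtain U \<phi> where U: "(U, \<phi>) \<in> A" "p \<in> U" using C0_extension_chart[OF ext p] by blast
  note homeo = C0_extension_homeo[OF ext U(1)]
  note UX = C0_extension_openin[OF ext U(1)]
  have UU: "topspace X \<inter> U = U" using openin_subset[OF UX] by blast
  have inj: "inj_on \<phi> U"
    using homeomorphic_imp_injective_map[OF homeo] by (simp add: UU)
  define y0 where "y0 = \<phi> p"
  have y0: "y0 \<in> \<phi> ` U" using U by (simp add: y0_def)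
  obtain L :: "'d spt \<Rightarrow> 'd spt" where L: "linear L" "bij L" "\<forall>v w. G (U, \<phi>) y0 (L v) (L w) = minkowski v w"
    using C0_extension_form[OF ext U(1) y0] unfolding lorentz_form_def by blast
  define J where "J = inv L"
  have J: "linear J" unfolding J_def using L(1,2) by (simp add: eucl.inj_linear_imp_inv_linear bij_is_inj)
  have LJ: "L (J v) = v" for v unfolding J_def using L(2) by (simp add: bij_is_surj surj_f_inv_f)
  have Jbl: "bounded_linear J" using J by (simp add: linear_conv_bounded_linear)
  have Jc: "continuous_on S f \<Longrightarrow> continuous_on S (\<lambda>x. J (f x))" for S :: "'z::topological_space set" and f
    by (rule bounded_linear.continuous_on[OF Jbl])
  define B where "B y v w = G (U, \<phi>) y (L v) (L w)" for y v w
  have bl: "bilinear (B y)" if "y \<in> \<phi> ` U" for y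
  proof -
    have "linear (G (U, \<phi>) y v)" "linear (\<lambda>w. G (U, \<phi>) y w v)" for v
      using bilinear_lorentz_form[OF C0_extension_form[OF ext U(1) that]] unfolding bilinear_def by blast+
    from linear_compose[OF L(1) this(1)] linear_compose[OF L(1) this(2)]
    show ?thesis unfolding bilinear_def B_def o_def by blast
  qed
  have bc: "continuous_on (\<phi> ` U) (\<lambda>y. B y v w)" for v w
    unfolding B_def by (rule C0_extension_continuous[OF ext U(1)])
  \<comment> \<open>With \<open>f\<close> and \<open>s\<close> the squared time and space parts of a
    timelike vector, the tolerance 1/4 yields \<open>s \<le> 5 / 3 * f\<close> and squared length at
    most \<open>5 / 4 * f\<close>, both within the factor 4 that \<open>cone\<close> and
    \<open>len\<close> allow.\<close>
  have quarter: "0 < (1 / 4 :: real)" by simp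
  obtain r where r: "0 < r" "ball y0 r \<subseteq> \<phi> ` U"
    "\<forall>y\<in>ball y0 r. \<forall>v. \<bar>B y v v - B y0 v v\<bar> \<le> (1 / 4) * (norm v)\<^sup>2"
    using bilinear_forms_close[OF C0_extension_open[OF ext U(1)] y0 bl bc quarter] by blast
  obtain C where C: "0 < C" "\<And>v. norm (L v) \<le> C * norm v"
    using linear_bounded_pos[OF L(1)] by metis
  \<comment> \<open>\<open>C\<close> bounds the stretching by \<open>L\<close>, so
    \<open>J\<close>-coordinates of norm below \<open>R\<close> come from points of the ball of
    radius \<open>r\<close>.\<close>
  define R where "R = r / C"
  have R: "0 < R" using r(1) C(1) by (simp add: R_def)
  have ball: "y \<in> ball y0 r" if "norm (J (y - y0)) < R" for y
  proof -
    have "norm (y - y0) \<le> C * norm (J (y - y0))" using C(2)[of "J (y - y0)"] by (simp add: LJ)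
    also have "\<dots> < C * R" using that C(1) by simp
    finally show ?thesis using C(1) by (simp add: R_def dist_norm norm_minus_commute)
  qed
  define V where "V = kasner_M \<inter> \<iota> -` U"
  define \<Psi> where "\<Psi> q = J (\<phi> (\<iota> q) - y0)" for q
  define \<Psi>' where "\<Psi>' q v = J (frechet_derivative (\<phi> \<circ> \<iota>) (at q) v)" for q v
  define W where "W = V \<inter> {q. norm (\<Psi> q) < R}"
  have Vo: "open V" unfolding V_def by (rule C0_extension_open_preimage[OF ext U(1)])
  have Pd: "(\<Psi> has_derivative \<Psi>' q) (at q)" if "q \<in> V" for q
  proof -
    have "((\<phi> \<circ> \<iota>) has_derivative frechet_derivative (\<phi> \<circ> \<iota>) (at q)) (at q)"
      using C0_extension_chart_derivative[OF ext U(1), of q] that by (simp only: V_def)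
    from bounded_linear.has_derivative[OF Jbl has_derivative_diff[OF this has_derivative_const[of y0]]]
    show ?thesis unfolding \<Psi>_def \<Psi>'_def by (simp only: diff_zero o_apply)
  qed
  have Pc: "continuous_on V \<Psi>"
    by (intro continuous_at_imp_continuous_on ballI has_derivative_continuous[OF Pd])
  have met: "\<bar>kasner_g P q w w - minkowski (\<Psi>' q w) (\<Psi>' q w)\<bar> \<le> (1 / 4) * (norm (\<Psi>' q w))\<^sup>2"
    if "q \<in> W" for q w
  proof -
    have "kasner_g P q w w = B (\<phi> (\<iota> q)) (\<Psi>' q w) (\<Psi>' q w)"
      using C0_extension_isometric[OF ext U(1), of q w w] that by (simp add: B_def \<Psi>'_def LJ W_def V_def)
    moreover have "minkowski (\<Psi>' q w) (\<Psi>' q w) = B y0 (\<Psi>' q w) (\<Psi>' q w)"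
      unfolding B_def by (rule L(3)[rule_format, symmetric])
    moreover have "\<phi> (\<iota> q) \<in> ball y0 r" using that by (intro ball) (auto simp: W_def \<Psi>_def)
    ultimately show ?thesis using r(3)[rule_format, of "\<phi> (\<iota> q)" "\<Psi>' q w"] by simp
  qed
  have split: "(norm v)\<^sup>2 = (fst v)\<^sup>2 + (norm (snd v))\<^sup>2" "minkowski v v = - (fst v)\<^sup>2 + (norm (snd v))\<^sup>2"
    for v :: "'d spt"
    by (simp_all add: norm_prod_def minkowski_def dot_square_norm flip: power2_eq_square)
  have sq: "(norm (snd (\<Psi>' q w)))\<^sup>2 \<le> 5 / 3 * (fst (\<Psi>' q w))\<^sup>2"
    if "q \<in> W" "kasner_g P q w w < 0" for q w
  proof -
    have "s \<le> 5 / 3 * f" if "\<bar>g - (- f + s)\<bar> \<le> (1 / 4) * (f + s)" "g < 0" for f g s :: real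
    proof -
      have "- (g - (- f + s)) \<le> (1 / 4) * (f + s)" by (rule order_trans[OF abs_ge_minus_self that(1)])
      then show ?thesis using that(2) by (simp add: field_simps)
    qed
    then show ?thesis using met[OF that(1), of w] that(2) unfolding split .
  qed
  have chart: "kasner_chart P W \<Psi> \<Psi>' (R / 2)"
  proof
    show "open W"
    proof -
      have "open (V \<inter> \<Psi> -` {y. norm y < R})"
        by (intro continuous_open_preimage Pc Vo open_Collect_less continuous_intros)
      then show ?thesis by (simp add: W_def vimage_def)
    qed
    show "(\<Psi> has_derivative \<Psi>' q) (at q)" if "q \<in> W" for q
      using that Pd by (simp add: W_def)
    show "norm (snd (\<Psi>' q w)) \<le> 2 * \<bar>fst (\<Psi>' q w)\<bar>" if "q \<in> W" "kasner_g P q w w < 0" for q w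
    proof (rule power2_le_imp_le)
      have "5 / 3 * (fst (\<Psi>' q w))\<^sup>2 \<le> 4 * (fst (\<Psi>' q w))\<^sup>2" by simp
      from order_trans[OF sq[OF that] this]
      show "(norm (snd (\<Psi>' q w)))\<^sup>2 \<le> (2 * \<bar>fst (\<Psi>' q w)\<bar>)\<^sup>2"
        by (simp add: power_mult_distrib)
    qed simp
    show "- kasner_g P q w w \<le> 4 * (fst (\<Psi>' q w))\<^sup>2" if "q \<in> W" "kasner_g P q w w < 0" for q w
    proof -
      have "- g \<le> 4 * f" if "\<bar>g - (- f + s)\<bar> \<le> (1 / 4) * (f + s)" "s \<le> 5 / 3 * f" "0 \<le> s" "0 \<le> f"
        for f g s :: real
      proof -
        have "- (g - (- f + s)) \<le> (1 / 4) * (f + s)" by (rule order_trans[OF abs_ge_minus_self that(1)])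
        then show ?thesis using that(2-4) by (simp add: field_simps)
      qed
      then show ?thesis
        using met[OF that(1), of w] sq[OF that] zero_le_power2[of "norm (snd (\<Psi>' q w))"]
          zero_le_power2[of "fst (\<Psi>' q w)"] unfolding split .
    qed
    have "continuous_on V (\<lambda>q. \<Psi>' q (1, 0))"
      unfolding \<Psi>'_def V_def by (intro Jc C0_extension_continuous_derivative[OF ext U(1)])
    then show "continuous_on W (\<lambda>q. fst (\<Psi>' q (1, 0)))"
      by (rule continuous_on_fst[OF continuous_on_subset]) (auto simp: W_def)
    \<comment> \<open>The radius \<open>R / 2\<close> leaves a margin inside \<open>W\<close>. The
      closed ball is compact in the chart, so its copy in \<open>X\<close> is compact and, by the
      Hausdorff property, closed; continuity of \<open>\<iota>\<close> pulls it back to a closed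
      subset of \<open>kasner_M\<close>.\<close>
    define K where "K = {y. norm (J (y - y0)) \<le> R / 2}"
    have Ksub: "K \<subseteq> ball y0 r" using R ball by (auto simp: K_def)
    have "compact K"
    proof -
      have "closed K" unfolding K_def by (intro closed_Collect_le continuous_intros Jc)
      moreover have "bounded K" using Ksub bounded_ball bounded_subset by blast
      ultimately show ?thesis by (simp add: compact_eq_bounded_closed)
    qed
    moreover have "\<phi> ` (U \<inter> \<phi> -` K) = K" using Ksub r(2) by blast
    ultimately have "compactin (top_of_set (\<phi> ` U)) (\<phi> ` (U \<inter> \<phi> -` K))"
      using order_trans[OF Ksub r(2)] by (simp add: compactin_subtopology)
    then have "compactin (subtopology X U) (U \<inter> \<phi> -` K)"
      using homeomorphic_map_compactness[OF homeo, of "U \<inter> \<phi> -` K"] UU by auto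
    then have "closedin X (U \<inter> \<phi> -` K)"
      using compactin_imp_closedin[OF C0_extension_Hausdorff[OF ext]] by (simp add: compactin_subtopology)
    from closedin_continuous_map_preimage[OF C0_extension_map[OF ext] this]
    show "closedin (top_of_set kasner_M) {q \<in> W. norm (\<Psi> q) \<le> R / 2}"
    proof -
      assume *: "closedin (top_of_set kasner_M) {x \<in> topspace (top_of_set kasner_M). \<iota> x \<in> U \<inter> \<phi> -` K}"
      have "{x \<in> topspace (top_of_set kasner_M). \<iota> x \<in> U \<inter> \<phi> -` K} = {q \<in> W. norm (\<Psi> q) \<le> R / 2}"
        using R by (auto simp: W_def V_def K_def \<Psi>_def)
      with * show ?thesis by metis
    qed
  qed
  define N where "N = U \<inter> \<phi> -` {y. norm (J (y - y0)) < R / 2 / 6}"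
  have N: "openin X N"
  proof -
    have "open {y. norm (J (y - y0)) < R / 2 / 6}" by (intro open_Collect_less continuous_intros Jc)
    moreover have "\<phi> ` N = \<phi> ` U \<inter> {y. norm (J (y - y0)) < R / 2 / 6}" by (auto simp: N_def)
    ultimately have "openin (top_of_set (\<phi> ` U)) (\<phi> ` N)" by auto
    then have "openin (subtopology X U) N"
      using homeomorphic_map_openness[OF homeo, of N] UU by (auto simp: N_def)
    then show ?thesis using UX by (meson openin_open_subtopology)
  qed
  have pN: "p \<in> N" using U R linear_0[OF J] by (simp add: N_def y0_def)
  have small: "q \<in> W \<and> norm (\<Psi> q) < R / 2 / 6" if "q \<in> kasner_M" "\<iota> q \<in> N" for q
    using that R by (auto simp: W_def V_def N_def \<Psi>_def)
  show thesis by (rule that[OF chart half_gt_zero[OF R] N pN small])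
qed

section \<open>Timelike curves approaching the future boundary\<close>

text \<open>\<open>c\<close> stands for the pull-back under \<open>\<iota>\<close> of a curve
  reaching the boundary, without its end point; at 0 the derivative is one-sided.\<close>

locale kasner_curve =
  fixes P :: "real^'d::finite" and c c' :: "real \<Rightarrow> 'd spt"
  assumes in_M: "s \<in> {0..<1} \<Longrightarrow> c s \<in> kasner_M"
    and curve_deriv: "s \<in> {0..<1} \<Longrightarrow> (c has_vector_derivative c' s) (at s within {0..<1})"
    and fdtl: "s \<in> {0..<1} \<Longrightarrow> kasner_fdtl P (c s) (c' s)"
begin

lemma curve_continuous: "continuous_on {0..<1} c"
  using curve_deriv by (meson continuous_on_eq_continuous_within has_vector_derivative_continuous)

lemma curve_deriv_at: "0 < s \<Longrightarrow> s < 1 \<Longrightarrow> (c has_vector_derivative c' s) (at s)"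
  using curve_deriv[of s] by (simp add: at_within_interior[of s "{0..<1}"])

lemma time_deriv: "0 < s \<Longrightarrow> s < 1 \<Longrightarrow> ((\<lambda>s. fst (c s)) has_real_derivative fst (c' s)) (at s)"
  using bounded_linear.has_vector_derivative[OF bounded_linear_fst curve_deriv_at]
  by (simp add: has_real_derivative_iff_has_vector_derivative)

lemma time_deriv_pos: "s \<in> {0..<1} \<Longrightarrow> 0 < fst (c' s)"
  using fdtl by (simp add: kasner_fdtl_def)

lemma spatial_sq_less: "s \<in> {0..<1} \<Longrightarrow> spatial_sq P (fst (c s)) (snd (c' s)) < (fst (c' s))\<^sup>2"
  using fdtl[of s] by (simp add: kasner_fdtl_def kasner_g_spatial_sq)

lemma time_mono: "fst (c r) < fst (c s)" if "0 \<le> r" "r < s" "s < 1"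
proof (rule DERIV_pos_imp_increasing_open[OF that(2)])
  show "\<exists>y. ((\<lambda>s. fst (c s)) has_real_derivative y) (at t) \<and> 0 < y" if "r < t" "t < s" for t
    using time_deriv[of t] time_deriv_pos[of t] that \<open>0 \<le> r\<close> \<open>s < 1\<close> by auto
  show "continuous_on {r..s} (\<lambda>s. fst (c s))"
    using that by (intro continuous_intros continuous_on_subset[OF curve_continuous]) auto
qed

text \<open>With time between the positive initial value and \<open>T\<close>,
  \<open>norm_le_spatial_sq\<close> bounds the spatial speed by a constant times the time speed.
  Integration confines the curve to a box, which avoids time 0.\<close>

lemma compact_range:
  assumes T: "\<And>s. s \<in> {0..<1} \<Longrightarrow> fst (c s) \<le> T"
  obtains K where "compact K" "K \<subseteq> kasner_M" "c ` {0..<1} \<subseteq> K"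
proof -
  define a where "a = fst (c 0)"
  have a: "0 < a" using in_M[of 0] by (simp add: kasner_M_def a_def)
  have low: "a \<le> fst (c s)" if "s \<in> {0..<1}" for s
    using time_mono[of 0 s] that by (cases "s = 0") (auto simp: a_def)
  define C where "C = (\<Sum>i\<in>UNIV. a powr (- P $ i) + T powr (- P $ i))"
  have C: "0 \<le> C" unfolding C_def by (intro sum_nonneg) auto
  have speed: "norm (snd (c' s)) \<le> C * fst (c' s)" if "s \<in> {0..<1}" for s
  proof -
    have "norm (snd (c' s)) \<le> C * sqrt (spatial_sq P (fst (c s)) (snd (c' s)))"
      unfolding C_def using a low[OF that] T[OF that] by (rule norm_le_spatial_sq)
    also have "\<dots> \<le> C * fst (c' s)"
      using spatial_sq_less[OF that] time_deriv_pos[OF that] C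
      by (intro mult_left_mono real_le_lsqrt) auto
    finally show ?thesis .
  qed
  have dist: "norm (snd (c s) - snd (c 0)) \<le> C * (T - a)" if s: "s \<in> {0..<1}" for s
  proof (cases "s = 0")
    case True
    then show ?thesis using C T[OF s] low[OF s] by simp
  next
    case False
    have cs: "continuous_on {0..s} c" using s by (intro continuous_on_subset[OF curve_continuous]) auto
    have "norm (snd (c s) - snd (c 0)) \<le> C * fst (c s) - C * fst (c 0)"
    proof (rule differentiable_bound_general)
      show "0 < s" using s False by simp
      show "continuous_on {0..s} (\<lambda>r. snd (c r))" "continuous_on {0..s} (\<lambda>r. C * fst (c r))"
        by (intro continuous_intros cs)+
      fix r assume r: "0 < r" "r < s"
      then have r1: "r < 1" using s by simp
      show "((\<lambda>r. snd (c r)) has_vector_derivative snd (c' r)) (at r)"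
        by (rule bounded_linear.has_vector_derivative[OF bounded_linear_snd curve_deriv_at[OF r(1) r1]])
      show "((\<lambda>r. C * fst (c r)) has_vector_derivative C * fst (c' r)) (at r)"
        using DERIV_cmult[OF time_deriv[OF r(1) r1], of C]
        by (simp add: has_real_derivative_iff_has_vector_derivative)
      show "norm (snd (c' r)) \<le> C * fst (c' r)" using speed[of r] r r1 by simp
    qed
    also have "\<dots> \<le> C * (T - a)"
      using mult_left_mono[OF T[OF s] C] by (simp add: a_def algebra_simps)
    finally show ?thesis .
  qed
  show thesis
  proof
    show "compact ({a..T} \<times> cball (snd (c 0)) (C * (T - a)))" by (intro compact_Times) auto
    show "{a..T} \<times> cball (snd (c 0)) (C * (T - a)) \<subseteq> kasner_M" using a by (auto simp: kasner_M_def)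
    show "c ` {0..<1} \<subseteq> {a..T} \<times> cball (snd (c 0)) (C * (T - a))"
    proof (rule image_subsetI)
      fix s :: real assume s: "s \<in> {0..<1}"
      show "c s \<in> {a..T} \<times> cball (snd (c 0)) (C * (T - a))"
        using dist[OF s] low[OF s] T[OF s] by (simp add: mem_Times_iff dist_norm norm_minus_commute)
    qed
  qed
qed

text \<open>Time is strictly increasing and unbounded, so it has an inverse \<open>h\<close> on all
  later times. Dividing the velocity by its time component preserves the timelike condition, which
  is homogeneous.\<close>

lemma time_parametrization:
  assumes unbdd: "\<And>T. \<exists>s\<in>{0..<1}. T < fst (c s)"
  obtains x x' h where
    "\<And>t. fst (c 0) < t \<Longrightarrow> 0 < h t \<and> h t < 1 \<and> c (h t) = (t, x t)"
    "\<And>t. fst (c 0) < t \<Longrightarrow> (x has_vector_derivative x' t) (at t)"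
    "\<And>t. fst (c 0) < t \<Longrightarrow> spatial_sq P t (x' t) < 1"
proof -
  have "\<exists>s. 0 < s \<and> s < 1 \<and> fst (c s) = t" if t: "fst (c 0) < t" for t
  proof -
    obtain s1 where s1: "0 \<le> s1" "s1 < 1" "t < fst (c s1)" using unbdd[of t] by auto
    have "\<exists>s. 0 \<le> s \<and> s \<le> s1 \<and> fst (c s) = t"
      using s1 t by (intro IVT') (auto intro!: continuous_intros continuous_on_subset[OF curve_continuous])
    then obtain s where "0 \<le> s" "s \<le> s1" "fst (c s) = t" by blast
    then show ?thesis using s1 t by (intro exI[of _ s]) (auto simp: less_le)
  qed
  then obtain h where h: "\<And>t. fst (c 0) < t \<Longrightarrow> 0 < h t \<and> h t < 1 \<and> fst (c (h t)) = t"
    by metis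
  have inv: "h (fst (c s)) = s" if s: "0 < s" "s < 1" for s
    using h[OF time_mono[of 0 s]] s time_mono[of s "h (fst (c s))"] time_mono[of "h (fst (c s))" s]
    by (metis less_irrefl linorder_neqE_linordered_idom order.refl less_imp_le)
  have hd: "(h has_real_derivative inverse (fst (c' (h t)))) (at t)" if t: "fst (c 0) < t" for t
  proof (rule DERIV_inverse_function)
    note ht = h[OF t]
    show "((\<lambda>s. fst (c s)) has_real_derivative fst (c' (h t))) (at (h t))"
      using ht by (intro time_deriv) auto
    show "fst (c' (h t)) \<noteq> 0" using time_deriv_pos[of "h t"] ht by auto
    show "fst (c 0) < t" "t < t + 1" using t by auto
    show "fst (c (h y)) = y" if "fst (c 0) < y" for y using h[OF that] by simp
    \<comment> \<open>The midpoints between \<open>h t\<close> and the ends 0 and 1 bound a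
      neighbourhood on which \<open>h\<close> inverts the time function.\<close>
    have "isCont h (fst (c (h t)))"
    proof (rule isCont_inverse_function2[where f = "\<lambda>s. fst (c s)" and x = "h t" and a = "h t / 2" and b = "(h t + 1) / 2"])
      show "h t / 2 < h t" "h t < (h t + 1) / 2" using ht by auto
      fix z assume "h t / 2 \<le> z" "z \<le> (h t + 1) / 2"
      then have z: "0 < z" "z < 1" using ht by auto
      show "h (fst (c z)) = z" by (rule inv[OF z])
      show "isCont (\<lambda>s. fst (c s)) z" by (rule DERIV_isCont[OF time_deriv[OF z]])
    qed
    then show "isCont h t" using ht by simp
  qed
  show thesis
  proof
    fix t assume t: "fst (c 0) < t"
    note ht = h[OF t]
    have hin: "h t \<in> {0..<1}" using ht by auto
    show "0 < h t \<and> h t < 1 \<and> c (h t) = (t, (\<lambda>t. snd (c (h t))) t)"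
      using ht by (simp add: prod_eq_iff)
    have "((c \<circ> h) has_vector_derivative inverse (fst (c' (h t))) *\<^sub>R c' (h t)) (at t)"
      using hd[OF t] ht curve_deriv_at[of "h t"]
      by (intro vector_diff_chain_at) (auto simp: has_real_derivative_iff_has_vector_derivative)
    from bounded_linear.has_vector_derivative[OF bounded_linear_snd this]
    show "((\<lambda>t. snd (c (h t))) has_vector_derivative inverse (fst (c' (h t))) *\<^sub>R snd (c' (h t))) (at t)"
      by simp
    show "spatial_sq P t (inverse (fst (c' (h t))) *\<^sub>R snd (c' (h t))) < 1"
      using spatial_sq_less[OF hin] time_deriv_pos[OF hin] ht
      by (simp add: spatial_sq_scaleR field_simps)
  qed
qed

end

section \<open>From a future boundary point to a contradiction\<close>

theorem theorem4p1:
  fixes P :: "real^'d::finite"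
    and X :: "'b topology"
    and A :: "('b set \<times> ('b \<Rightarrow> 'd spt)) set"
    and G :: "'b set \<times> ('b \<Rightarrow> 'd spt) \<Rightarrow> 'd spt \<Rightarrow> 'd spt \<Rightarrow> 'd spt \<Rightarrow> real"
    and \<iota> :: "'d spt \<Rightarrow> 'b"
  assumes "CARD('d) \<ge> 3"
    and "(\<Sum>i\<in>UNIV. P $ i) = 1"
    and "(\<Sum>i\<in>UNIV. (P $ i)^2) = 1"
    and "\<exists>i. P $ i < 0"
    and "C0_extension P X A G \<iota>"
  shows "future_boundary P X A G \<iota> = {}"
proof (rule equals0I)
  fix p assume "p \<in> future_boundary P X A G \<iota>"
  then obtain \<gamma> a b where fr: "p \<in> X frontier_of (\<iota> ` kasner_M)" and ab: "a < 0" "1 < b"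
    and sm: "smooth_map_into X A {a<..<b} \<gamma>" and sub: "\<gamma> ` {0..<1} \<subseteq> \<iota> ` kasner_M"
    and der: "\<forall>s\<in>{0..<1}. \<exists>v. ((\<lambda>r. the_inv_into kasner_M \<iota> (\<gamma> r)) has_vector_derivative v) (at s within {0..<1})
                              \<and> kasner_fdtl P (the_inv_into kasner_M \<iota> (\<gamma> s)) v"
    and p: "\<gamma> 1 = p"
    unfolding future_boundary_def by blast
  note ext = assms(5)
  \<comment> \<open>The image is open, so its frontier is disjoint from it.\<close>
  have "X interior_of (\<iota> ` kasner_M) = \<iota> ` kasner_M"
    using C0_extension_openin_image[OF ext] by (simp add: interior_of_eq)
  then have p_notin: "p \<notin> \<iota> ` kasner_M" and pX: "p \<in> topspace X"
    using fr frontier_of_subset_topspace[of X] by (auto simp: frontier_of_def)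
  have near: "\<exists>r. 0 \<le> r \<and> r < 1 \<and> (\<forall>s. r < s \<longrightarrow> s < 1 \<longrightarrow> \<gamma> s \<in> N)" if N: "openin X N" "p \<in> N" for N
  proof -
    have "continuous_map (top_of_set {a<..<b}) X \<gamma>" using sm by (simp add: smooth_map_into_def)
    from openin_continuous_map_preimage[OF this N(1)]
    have "open {s \<in> {a<..<b}. \<gamma> s \<in> N}" by (simp add: openin_open_eq)
    moreover have "1 \<in> {s \<in> {a<..<b}. \<gamma> s \<in> N}" using ab p N by simp
    ultimately obtain e where e: "0 < e" "ball 1 e \<subseteq> {s \<in> {a<..<b}. \<gamma> s \<in> N}"
      unfolding open_contains_ball by blast
    then show ?thesis
      by (intro exI[of _ "max 0 (1 - e)"]) (auto simp: dist_real_def subset_iff)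
  qed
  define c where "c s = the_inv_into kasner_M \<iota> (\<gamma> s)" for s
  have c: "c s \<in> kasner_M" "\<iota> (c s) = \<gamma> s" if "s \<in> {0..<1}" for s
    using the_inv_into_into[OF C0_extension_inj[OF ext], of "\<gamma> s" kasner_M]
      f_the_inv_into_f[OF C0_extension_inj[OF ext], of "\<gamma> s"] sub that
    unfolding c_def by blast+
  obtain c' where c': "\<And>s. s \<in> {0..<1} \<Longrightarrow> (c has_vector_derivative c' s) (at s within {0..<1}) \<and> kasner_fdtl P (c s) (c' s)"
    using der unfolding c_def by metis
  interpret kasner_curve P c c'
    using c(1) c' by unfold_locales blast+
  have unbdd: "\<exists>s\<in>{0..<1}. T < fst (c s)" for T
  proof (rule ccontr)
    assume "\<not> ?thesis"
    then have "fst (c s) \<le> T" if "s \<in> {0..<1}" for s using that by force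
    then obtain K where K: "compact K" "K \<subseteq> kasner_M" "c ` {0..<1} \<subseteq> K"
      using compact_range by metis
    have "compactin X (\<iota> ` K)"
      using K by (intro image_compactin[OF _ C0_extension_map[OF ext]]) (simp add: compactin_subtopology)
    then have "closedin X (\<iota> ` K)"
      by (rule compactin_imp_closedin[OF C0_extension_Hausdorff[OF ext]])
    then have "openin X (topspace X - \<iota> ` K)" by (simp add: openin_diff)
    moreover have "p \<in> topspace X - \<iota> ` K" using p_notin pX K(2) by blast
    ultimately obtain r where r: "0 \<le> r" "r < 1" "\<And>s. r < s \<Longrightarrow> s < 1 \<Longrightarrow> \<gamma> s \<notin> \<iota> ` K"
      using near by (metis DiffD2)
    define s where "s = (r + 1) / 2"
    have s: "s \<in> {0..<1}" "r < s" "s < 1" using r(1,2) by (auto simp: s_def)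
    have "\<gamma> s \<in> \<iota> ` K" using c(2)[OF s(1)] s(1) K(3) by (metis image_eqI image_subset_iff)
    then show False using r(3)[OF s(2,3)] by contradiction
  qed
  obtain x x' h where h: "\<And>t. fst (c 0) < t \<Longrightarrow> 0 < h t \<and> h t < 1 \<and> c (h t) = (t, x t)"
    and xd: "\<And>t. fst (c 0) < t \<Longrightarrow> (x has_vector_derivative x' t) (at t)"
    and xt: "\<And>t. fst (c 0) < t \<Longrightarrow> spatial_sq P t (x' t) < 1"
    using time_parametrization[OF unbdd] by metis
  obtain W \<Psi> \<Psi>' \<rho> N where chart: "kasner_chart P W \<Psi> \<Psi>' \<rho>" and rho: "0 < \<rho>" and N: "openin X N" "p \<in> N"
    and small: "\<And>q. q \<in> kasner_M \<Longrightarrow> \<iota> q \<in> N \<Longrightarrow> q \<in> W \<and> norm (\<Psi> q) < \<rho> / 6"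
    using C0_extension_kasner_chart[OF ext pX] by metis
  obtain r where r: "0 \<le> r" "r < 1" "\<And>s. r < s \<Longrightarrow> s < 1 \<Longrightarrow> \<gamma> s \<in> N"
    using near[OF N] by blast
  \<comment> \<open>By monotonicity of time, \<open>t > t0\<close> forces \<open>h t > r\<close>, so
    the graph lies in \<open>N\<close> after time \<open>t0\<close>.\<close>
  define t0 where "t0 = fst (c r)"
  have t0: "fst (c 0) \<le> t0" "0 \<le> t0"
    using time_mono[of 0 r] c(1)[of r] r by (cases "r = 0"; force simp: t0_def kasner_M_def)+
  have inW: "(t, x t) \<in> W \<and> norm (\<Psi> (t, x t)) < \<rho> / 6" if t: "t0 < t" for t
  proof -
    have t': "fst (c 0) < t" using t0 t by linarith
    note ht = h[OF t']
    have "r < h t"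
    proof (rule ccontr)
      assume "\<not> r < h t"
      then have "fst (c (h t)) \<le> t0"
        using time_mono[of "h t" r] ht r by (cases "h t = r") (auto simp: t0_def)
      then show False using ht t by simp
    qed
    then have "\<gamma> (h t) \<in> N" using ht r by simp
    then show ?thesis using small[of "c (h t)"] c[of "h t"] ht by simp
  qed
  \<comment> \<open>A maximum of finitely many numbers below 1, by
    \<open>kasner_exponent_gt\<close>; the strict inequality \<open>k < 1\<close> is what makes the
    comparison length unbounded. Inserting 0 gives \<open>0 \<le> k\<close>.\<close>
  define k where "k = Max (insert 0 (range (\<lambda>i. - P $ i)))"
  have k: "0 \<le> k" "k < 1" and Pk: "- k \<le> P $ i" for i
  proof -
    show "0 \<le> k" unfolding k_def by (rule Max_ge) auto
    show "k < 1" unfolding k_def using kasner_exponent_gt[OF assms(2,3)]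
      by (subst Max_less_iff) (auto simp: minus_less_iff)
    have "- P $ i \<le> k" unfolding k_def by (rule Max_ge) auto
    then show "- k \<le> P $ i" by linarith
  qed
  show False
    by (rule kasner_chart.no_escape[OF chart k Pk rho t0(2), of x x'])
       (use xd xt inW t0(1) in auto)
qed

end
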